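(* Let $a>0$, $\sigma\in[0,\sqrt a)$, let $B,W$ be independent real Brownian motions, and for $\zeta=(\xi,\eta)\in\mathbb{R}^2$ let $Z^\zeta_t=(X_t,V_t)$ be the solution, starting from $\zeta$ at time $0$, of the linear SDE $$dX_t=V_tdt,\qquad dV_t=\sqrt{a-\sigma^2}\,dB_t-\sigma\,dW_t.$$ Let $\Gamma(t,\cdot;0,\zeta)$, $t>0$, be the fundamental solution of the Langevin SPDE $d_{\mathbf{Y}}u_t=\frac a2\partial_{vv}u_tdt+\sigma\partial_vu_tdW_t$, $\mathbf{Y}=\partial_t+v\partial_x$, given explicitly by $$\Gamma(t,z;0,\zeta)=\frac{1}{2\pi\sqrt{\det\mathcal{C}_t}}\exp\left(-\frac12\left\langle\mathcal{C}_t^{-1}(z-m_t(\zeta)),z-m_t(\zeta)\right\rangle\right),\qquad z\in\mathbb{R}^2,$$ $$m_t(\zeta)=\begin{pmatrix}\xi+t\eta-\sigma\int_0^t(t-s)dW_s\\ \eta-\sigma W_t\end{pmatrix},\qquad \mathcal{C}_t=(a-\sigma^2)\begin{pmatrix}\frac{t^3}{3}&\frac{t^2}{2}\\ \frac{t^2}{2}&t\end{pmatrix}.$$ Then for any bounded and measurable function $\varphi$ on $\mathbb{R}^2$ and $t>0$, $$E\left[\varphi(Z^\zeta_t)\mid\mathcal{F}^W_t\right]=\int_{\mathbb{R}^2}\varphi(z)\Gamma(t,z;0,\zeta)dz.$$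
   Context: $\mathcal{F}^W_t=\sigma(W_s,\,s\le t)$ is the filtration generated by $W$. Equality of conditional expectations is $P$-almost sure. *)

theory Defs
  imports "HOL-Probability.Probability"
begin

text \<open>Stochastic processes are functions \<open>real \<Rightarrow> 'a \<Rightarrow> _\<close>; only the times \<open>t \<ge> 0\<close> are meaningful.\<close>

text \<open>The \<open>\<sigma>\<close>-algebra \<open>\<sigma>(Y\<^sub>s, s \<in> T)\<close> on \<open>space M\<close>. It is not completed with null sets.\<close>

definition process_algebra :: "'a measure \<Rightarrow> (real \<Rightarrow> 'a \<Rightarrow> real) \<Rightarrow> real set \<Rightarrow> 'a measure" where
  "process_algebra M Y T =
     sigma (space M) {Y s -` A \<inter> space M | s A. s \<in> T \<and> A \<in> sets borel}"

definition natural_filtration :: "'a measure \<Rightarrow> (real \<Rightarrow> 'a \<Rightarrow> real) \<Rightarrow> real \<Rightarrow> 'a measure" where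
  "natural_filtration M Y t = process_algebra M Y {0..t}"

definition indep_processes ::
  "'a measure \<Rightarrow> (real \<Rightarrow> 'a \<Rightarrow> real) \<Rightarrow> (real \<Rightarrow> 'a \<Rightarrow> real) \<Rightarrow> bool" where
  "indep_processes M Y Y' \<longleftrightarrow>
     prob_space.indep_set M (sets (process_algebra M Y {0..})) (sets (process_algebra M Y' {0..}))"

definition brownian_motion :: "'a measure \<Rightarrow> (real \<Rightarrow> 'a \<Rightarrow> real) \<Rightarrow> bool" where
  "brownian_motion M W \<longleftrightarrow>
     (\<forall>t\<ge>0. W t \<in> borel_measurable M) \<and>
     (AE \<omega> in M. W 0 \<omega> = 0) \<and>
     (\<forall>n \<tau>. 0 \<le> \<tau> 0 \<and> (\<forall>i<n. \<tau> i < \<tau> (Suc i)) \<longrightarrow>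
        prob_space.indep_vars M (\<lambda>_. borel) (\<lambda>i \<omega>. W (\<tau> (Suc i)) \<omega> - W (\<tau> i) \<omega>) {..<n::nat}) \<and>
     (\<forall>s t. 0 \<le> s \<and> s < t \<longrightarrow>
        distributed M lborel (\<lambda>\<omega>. W t \<omega> - W s \<omega>) (normal_density 0 (sqrt (t - s)))) \<and>
     (AE \<omega> in M. continuous_on {0..} (\<lambda>t. W t \<omega>))"

text \<open>
  The stochastic integral \<open>\<integral>\<^sub>0\<^sup>t f(s) dW\<^sub>s\<close> of a deterministic integrand. A list of triples
  \<open>(c, u, v)\<close> encodes the step function \<open>\<Sum> c 1\<^bsub>(u, v]\<^esub>\<close>, whose integral is
  \<open>\<Sum> c (W\<^sub>v - W\<^sub>u)\<close>; the intervals may overlap. The general integral is the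
  \<open>L\<^sup>2(M)\<close>-limit of the integrals of step functions that converge to \<open>f\<close> in \<open>L\<^sup>2(0, t)\<close>,
  and is therefore determined only up to almost sure equality.
\<close>

definition step_fun :: "(real \<times> real \<times> real) list \<Rightarrow> real \<Rightarrow> real" where
  "step_fun l s = (\<Sum>(c, u, v)\<leftarrow>l. c * indicator {u<..v} s)"

definition step_integral ::
  "(real \<Rightarrow> 'a \<Rightarrow> real) \<Rightarrow> (real \<times> real \<times> real) list \<Rightarrow> 'a \<Rightarrow> real" where
  "step_integral W l \<omega> = (\<Sum>(c, u, v)\<leftarrow>l. c * (W v \<omega> - W u \<omega>))"

definition has_wiener_integral ::
  "'a measure \<Rightarrow> (real \<Rightarrow> 'a \<Rightarrow> real) \<Rightarrow> real \<Rightarrow> (real \<Rightarrow> real) \<Rightarrow> ('a \<Rightarrow> real) \<Rightarrow> bool" where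
  "has_wiener_integral M W t f J \<longleftrightarrow>
     f \<in> borel_measurable borel \<and> J \<in> borel_measurable M \<and>
     (\<exists>l :: nat \<Rightarrow> (real \<times> real \<times> real) list.
        (\<forall>n. \<forall>(c, u, v)\<in>set (l n). 0 \<le> u \<and> u \<le> v \<and> v \<le> t) \<and>
        (\<lambda>n. \<integral>\<^sup>+s\<in>{0..t}. ennreal ((f s - step_fun (l n) s)\<^sup>2) \<partial>lborel) \<longlonglongrightarrow> 0 \<and>
        (\<lambda>n. \<integral>\<^sup>+\<omega>. ennreal ((J \<omega> - step_integral W (l n) \<omega>)\<^sup>2) \<partial>M) \<longlonglongrightarrow> 0)"

definition wiener_integral ::
  "'a measure \<Rightarrow> (real \<Rightarrow> 'a \<Rightarrow> real) \<Rightarrow> real \<Rightarrow> (real \<Rightarrow> real) \<Rightarrow> 'a \<Rightarrow> real" where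
  "wiener_integral M W t f = (SOME J. has_wiener_integral M W t f J)"

text \<open>
  \<open>Z = (X, V)\<close> is a continuous solution, in integral form, of \<open>dX = V dt\<close>,
  \<open>dV = sqrt (a - \<sigma>\<^sup>2) dB - \<sigma> dW\<close> with \<open>Z\<^sub>0 = \<zeta>\<close>.
\<close>

definition langevin_solution ::
  "'a measure \<Rightarrow> (real \<Rightarrow> 'a \<Rightarrow> real) \<Rightarrow> (real \<Rightarrow> 'a \<Rightarrow> real) \<Rightarrow> real \<Rightarrow> real \<Rightarrow> real^2 \<Rightarrow>
     (real \<Rightarrow> 'a \<Rightarrow> real^2) \<Rightarrow> bool" where
  "langevin_solution M B W a \<sigma> \<zeta> Z \<longleftrightarrow>
     (\<forall>t\<ge>0. Z t \<in> borel_measurable M) \<and>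
     (AE \<omega> in M. continuous_on {0..} (\<lambda>t. Z t \<omega>)) \<and>
     (\<forall>t\<ge>0. AE \<omega> in M. Z t \<omega> $ 1 = \<zeta> $ 1 + (LBINT s:{0..t}. Z s \<omega> $ 2)) \<and>
     (\<forall>t\<ge>0. AE \<omega> in M. Z t \<omega> $ 2 =
        \<zeta> $ 2 + wiener_integral M B t (\<lambda>s. sqrt (a - \<sigma>\<^sup>2)) \<omega> - wiener_integral M W t (\<lambda>s. \<sigma>) \<omega>)"

definition langevin_mean ::
  "'a measure \<Rightarrow> (real \<Rightarrow> 'a \<Rightarrow> real) \<Rightarrow> real \<Rightarrow> real \<Rightarrow> real^2 \<Rightarrow> 'a \<Rightarrow> real^2" where
  "langevin_mean M W \<sigma> t \<zeta> \<omega> =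
     vector [\<zeta> $ 1 + t * \<zeta> $ 2 - \<sigma> * wiener_integral M W t (\<lambda>s. t - s) \<omega>,
             \<zeta> $ 2 - \<sigma> * W t \<omega>]"

definition langevin_cov :: "real \<Rightarrow> real \<Rightarrow> real \<Rightarrow> real^2^2" where
  "langevin_cov a \<sigma> t =
     (a - \<sigma>\<^sup>2) *\<^sub>R vector [vector [t^3 / 3, t^2 / 2],
                         vector [t^2 / 2, t]]"

text \<open>\<open>\<Gamma>(t, z; 0, \<zeta>)\<close>, a random field through its dependence on the path of \<open>W\<close>.\<close>

definition langevin_fundamental_solution ::
  "'a measure \<Rightarrow> (real \<Rightarrow> 'a \<Rightarrow> real) \<Rightarrow> real \<Rightarrow> real \<Rightarrow> real \<Rightarrow> real^2 \<Rightarrow> real^2 \<Rightarrow> 'a \<Rightarrow> real" where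
  "langevin_fundamental_solution M W a \<sigma> t z \<zeta> \<omega> =
     1 / (2 * pi * sqrt (det (langevin_cov a \<sigma> t))) *
     exp (- (1/2) * ((matrix_inv (langevin_cov a \<sigma> t) *v (z - langevin_mean M W \<sigma> t \<zeta> \<omega>))
                       \<bullet> (z - langevin_mean M W \<sigma> t \<zeta> \<omega>)))"

end

theory Submission
  imports Defs
begin

text \<open>
  The equation is linear, so its solution is explicit. Writing \<open>c = sqrt (a - \<sigma>\<^sup>2)\<close>,
  the velocity is \<open>V\<^sub>t = \<eta> + c B\<^sub>t - \<sigma> W\<^sub>t\<close>, and integrating in time,
  \<open>Z\<^sub>t = m\<^sub>t(\<zeta>) + c (\<integral>\<^sub>0\<^sup>t B\<^sub>s ds, B\<^sub>t)\<close> with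
  \<open>m\<^sub>t(\<zeta>) = (\<xi> + t \<eta> - \<sigma> \<integral>\<^sub>0\<^sup>t W\<^sub>s ds, \<eta> - \<sigma> W\<^sub>t)\<close> (lemma \<open>langevin_solution_eq\<close>). The first summand depends only
  on the path of \<open>W\<close> up to time \<open>t\<close>, the second is independent of \<open>W\<close>. Conditioning on \<open>W\<close>
  therefore freezes the first summand and averages over the law of the second (lemma
  \<open>real_cond_exp_freezing\<close>), a centred Gaussian with covariance \<open>\<C>\<^sub>t\<close>. Since
  \<open>\<Gamma>(t, \<cdot>; 0, \<zeta>)\<close> is the Gaussian density with this covariance and mean \<open>m\<^sub>t(\<zeta>)\<close>, the claim follows.

  Three points need work. The first is the Wiener integral, which is given as an unspecified
  choice among \<open>L\<^sup>2\<close>-limits. The Ito isometry for step functions shows that any two limits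
  agree almost surely (\<open>has_wiener_integral_unique\<close>), and Riemann sums of the path exhibit one
  for the integrand \<open>t - s\<close>, namely \<open>\<integral>\<^sub>0\<^sup>t W\<^sub>s ds\<close>
  (\<open>has_wiener_integral_path_time_integral\<close>). These Riemann sums also provide versions that
  are measurable for the uncompleted filtration.

  The second is the joint law of \<open>\<integral>\<^sub>0\<^sup>t B\<^sub>s ds\<close> and \<open>B\<^sub>t\<close>. Every linear combination is an almost
  sure limit of sums of independent Gaussian increments, which gives the joint characteristic
  function (\<open>char_path_time_integral\<close>). After regression of the first variable on the second it
  factorises, and a factorised characteristic function forces independence by
  \<open>joint_law_eq_product_if_char_factorises\<close>. The latter is derived from the uniqueness theorem for
  measures on the line, applied to reweighted probabilities.

  The third is the identification of the density. The normalised pair of independent Gaussians is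
  mapped to \<open>c (\<integral>\<^sub>0\<^sup>t B\<^sub>s ds, B\<^sub>t)\<close> by a triangular matrix \<open>L\<close> with \<open>L L\<^sup>T = \<C>\<^sub>t\<close>, so that the change of variables is
  one-dimensional in each coordinate (\<open>triangular_gauss_law\<close>) and the resulting density
  is \<open>\<Gamma>\<close> after completing the square (\<open>langevin_fundamental_solution_eq\<close>).
\<close>

section \<open>The Wiener integral\<close>

lemma brownian_motion_measurable:
  "brownian_motion M W \<Longrightarrow> 0 \<le> t \<Longrightarrow> W t \<in> borel_measurable M"
  by (simp add: brownian_motion_def)

lemma brownian_motion_increment_distributed:
  "brownian_motion M W \<Longrightarrow> 0 \<le> s \<Longrightarrow> s < t \<Longrightarrow>
     distributed M lborel (\<lambda>\<omega>. W t \<omega> - W s \<omega>) (normal_density 0 (sqrt (t - s)))"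
  by (simp add: brownian_motion_def)

lemma brownian_motion_increment_square:
  assumes W: "brownian_motion M W" and s: "0 \<le> s" and t: "0 \<le> t"
  shows "has_bochner_integral M (\<lambda>\<omega>. (W t \<omega> - W s \<omega>)\<^sup>2) \<bar>t - s\<bar>"
proof -
  have main: "has_bochner_integral M (\<lambda>\<omega>. (W t \<omega> - W s \<omega>)\<^sup>2) (t - s)" if s: "0 \<le> s" and st: "s < t" for s t
  proof -
    note D = brownian_motion_increment_distributed[OF W s st]
    have *: "has_bochner_integral lborel (\<lambda>x. normal_density 0 (sqrt (t - s)) x * x\<^sup>2) (t - s)"
      using normal_moment_even[of "sqrt (t - s)" 0 1] st by (simp add: diff_divide_distrib)
    show ?thesis
      unfolding has_bochner_integral_iff
      using distributed_integrable[OF D, of "\<lambda>x. x\<^sup>2"] distributed_integral[OF D, of "\<lambda>x. x\<^sup>2"] *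
      by (simp add: has_bochner_integral_iff)
  qed
  consider "s < t" | "t < s" | "s = t" by linarith
  then show ?thesis
  proof cases
    case 1 with main[OF s 1] show ?thesis by simp
  next
    case 2 with main[OF t 2] show ?thesis by (simp add: power2_commute)
  next
    case 3 then show ?thesis by (simp add: has_bochner_integral_zero)
  qed
qed

text \<open>
  Polarisation: \<open>2 (W v - W u) (W v' - W u')\<close> is a signed sum of four squared increments, so the
  covariance follows from the variances, without sorting the four times. For ordered
  end points the right-hand side is the length of the overlap of the two time intervals.
\<close>

lemma brownian_motion_increment_product:
  assumes W: "brownian_motion M W" and "0 \<le> u" "0 \<le> v" "0 \<le> u'" "0 \<le> v'"
  shows "has_bochner_integral M (\<lambda>\<omega>. (W v \<omega> - W u \<omega>) * (W v' \<omega> - W u' \<omega>))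
    ((\<bar>v - u'\<bar> + \<bar>u - v'\<bar> - \<bar>v - v'\<bar> - \<bar>u - u'\<bar>) / 2)"
proof -
  have "has_bochner_integral M (\<lambda>\<omega>. ((W v \<omega> - W u' \<omega>)\<^sup>2 + (W u \<omega> - W v' \<omega>)\<^sup>2
      - (W v \<omega> - W v' \<omega>)\<^sup>2 - (W u \<omega> - W u' \<omega>)\<^sup>2) / 2)
      ((\<bar>v - u'\<bar> + \<bar>u - v'\<bar> - \<bar>v - v'\<bar> - \<bar>u - u'\<bar>) / 2)"
    by (intro has_bochner_integral_divide has_bochner_integral_add has_bochner_integral_diff
        brownian_motion_increment_square[OF W] assms)
  then show ?thesis
    by (rule has_bochner_integral_cong[THEN iffD1, rotated -1])
       (auto simp: power2_eq_square field_simps)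
qed

lemma interval_overlap:
  fixes u v u' v' :: real
  assumes "u \<le> v" "u' \<le> v'"
  shows "has_bochner_integral lborel (\<lambda>s. indicator {u<..v} s * indicator {u'<..v'} s)
    ((\<bar>v - u'\<bar> + \<bar>u - v'\<bar> - \<bar>v - v'\<bar> - \<bar>u - u'\<bar>) / 2)"
proof -
  have "has_bochner_integral lborel (indicator {max u u'<..min v v'} :: real \<Rightarrow> real)
      (measure lborel {max u u'<..min v v'})"
    by (rule has_bochner_integral_real_indicator)
       (simp, rule emeasure_bounded_finite, rule bounded_subset[OF bounded_closed_interval[of u v]], auto)
  moreover have "measure lborel {max u u'<..min v v'} =
      (\<bar>v - u'\<bar> + \<bar>u - v'\<bar> - \<bar>v - v'\<bar> - \<bar>u - u'\<bar>) / 2"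
    using assms by (cases "max u u' \<le> min v v'") (auto simp: max_def min_def abs_if split: if_splits)
  moreover have "(\<lambda>s. indicator {u<..v} s * indicator {u'<..v'} s :: real) = indicator {max u u'<..min v v'}"
    by (auto simp: fun_eq_iff split: split_indicator)
  ultimately show ?thesis by simp
qed

definition step_within :: "real \<Rightarrow> (real \<times> real \<times> real) list \<Rightarrow> bool" where
  "step_within t l \<longleftrightarrow> (\<forall>(c, u, v)\<in>set l. 0 \<le> u \<and> u \<le> v \<and> v \<le> t)"

lemma step_simps [simp]:
  "step_fun [] s = 0" "step_fun ((c, u, v) # l) s = c * indicator {u<..v} s + step_fun l s"
  "step_integral W [] \<omega> = 0"
  "step_integral W ((c, u, v) # l) \<omega> = c * (W v \<omega> - W u \<omega>) + step_integral W l \<omega>"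
  "step_within t []"
  "step_within t ((c, u, v) # l) \<longleftrightarrow> 0 \<le> u \<and> u \<le> v \<and> v \<le> t \<and> step_within t l"
  by (auto simp: step_fun_def step_integral_def step_within_def)

lemma step_increment_isometry:
  assumes W: "brownian_motion M W" and uv: "0 \<le> u" "u \<le> v" and l: "step_within t l"
  shows "\<exists>x. has_bochner_integral M (\<lambda>\<omega>. (W v \<omega> - W u \<omega>) * step_integral W l \<omega>) x \<and>
             has_bochner_integral lborel (\<lambda>s. indicator {u<..v} s * step_fun l s) x"
  using l
proof (induction l)
  case Nil
  show ?case by (auto intro!: exI[of _ 0])
next
  case (Cons p l)
  obtain c u' v' where p: "p = (c, u', v')" by (cases p) auto
  have uv': "0 \<le> u'" "u' \<le> v'" "step_within t l"
    using Cons.prems by (auto simp: p)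
  from Cons.IH[OF uv'(3)] obtain x where
    x: "has_bochner_integral M (\<lambda>\<omega>. (W v \<omega> - W u \<omega>) * step_integral W l \<omega>) x"
       "has_bochner_integral lborel (\<lambda>s. indicator {u<..v} s * step_fun l s) x" by blast
  let ?y = "(\<bar>v - u'\<bar> + \<bar>u - v'\<bar> - \<bar>v - v'\<bar> - \<bar>u - u'\<bar>) / 2"
  have 1: "has_bochner_integral M (\<lambda>\<omega>. c * ((W v \<omega> - W u \<omega>) * (W v' \<omega> - W u' \<omega>))
      + (W v \<omega> - W u \<omega>) * step_integral W l \<omega>) (c * ?y + x)"
    by (intro has_bochner_integral_add has_bochner_integral_mult_right x
        brownian_motion_increment_product[OF W]) (use uv uv' in auto)
  have 2: "has_bochner_integral lborel (\<lambda>s. c * (indicator {u<..v} s * indicator {u'<..v'} s)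
      + indicator {u<..v} s * step_fun l s) (c * ?y + x)"
    by (intro has_bochner_integral_add has_bochner_integral_mult_right x interval_overlap)
       (use uv uv' in auto)
  show ?case
    using 1 2 by (intro exI[of _ "c * ?y + x"]) (simp add: p algebra_simps)
qed

text \<open>
  The Ito isometry for step functions. Both sides are bilinear, so an induction on each of the
  two lists reduces it to a pair of single intervals, which may overlap arbitrarily. The common
  value \<open>x\<close> is left implicit in order to carry integrability through the induction together with
  the identity.
\<close>

lemma step_bilinear_isometry:
  assumes W: "brownian_motion M W" and l: "step_within t l" and k: "step_within t k"
  shows "\<exists>x. has_bochner_integral M (\<lambda>\<omega>. step_integral W k \<omega> * step_integral W l \<omega>) x \<and>
             has_bochner_integral lborel (\<lambda>s. step_fun k s * step_fun l s) x"
  using k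
proof (induction k)
  case Nil
  show ?case by (auto intro!: exI[of _ 0])
next
  case (Cons p k)
  obtain c u v where p: "p = (c, u, v)" by (cases p) auto
  have uv: "0 \<le> u" "u \<le> v" "step_within t k"
    using Cons.prems by (auto simp: p)
  from Cons.IH[OF uv(3)] obtain x where
    x: "has_bochner_integral M (\<lambda>\<omega>. step_integral W k \<omega> * step_integral W l \<omega>) x"
       "has_bochner_integral lborel (\<lambda>s. step_fun k s * step_fun l s) x" by blast
  from step_increment_isometry[OF W uv(1,2) l] obtain y where
    y: "has_bochner_integral M (\<lambda>\<omega>. (W v \<omega> - W u \<omega>) * step_integral W l \<omega>) y"
       "has_bochner_integral lborel (\<lambda>s. indicator {u<..v} s * step_fun l s) y" by blast
  have 1: "has_bochner_integral M (\<lambda>\<omega>. c * ((W v \<omega> - W u \<omega>) * step_integral W l \<omega>)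
      + step_integral W k \<omega> * step_integral W l \<omega>) (c * y + x)"
    by (intro has_bochner_integral_add has_bochner_integral_mult_right x y)
  have 2: "has_bochner_integral lborel (\<lambda>s. c * (indicator {u<..v} s * step_fun l s)
      + step_fun k s * step_fun l s) (c * y + x)"
    by (intro has_bochner_integral_add has_bochner_integral_mult_right x y)
  show ?case
    using 1 2 by (intro exI[of _ "c * y + x"]) (simp add: p algebra_simps)
qed

text \<open>
  A difference of two step functions is again a step function, which turns the isometry
  for inner products into one for \<open>L\<^sup>2\<close>-distances.
\<close>

lemma step_negate:
  "step_fun (l @ map (\<lambda>(c, u, v). (- c, u, v)) k) s = step_fun l s - step_fun k s"
  "step_integral W (l @ map (\<lambda>(c, u, v). (- c, u, v)) k) \<omega> = step_integral W l \<omega> - step_integral W k \<omega>"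
  "step_within t l \<Longrightarrow> step_within t k \<Longrightarrow> step_within t (l @ map (\<lambda>(c, u, v). (- c, u, v)) k)"
proof -
  have 1: "step_fun (map (\<lambda>(c, u, v). (- c, u, v)) k) s = - step_fun k s"
    by (induction k) auto
  have 2: "step_integral W (map (\<lambda>(c, u, v). (- c, u, v)) k) \<omega> = - step_integral W k \<omega>"
    by (induction k) (auto simp: algebra_simps)
  show "step_fun (l @ map (\<lambda>(c, u, v). (- c, u, v)) k) s = step_fun l s - step_fun k s"
    using 1 by (simp add: step_fun_def)
  show "step_integral W (l @ map (\<lambda>(c, u, v). (- c, u, v)) k) \<omega> = step_integral W l \<omega> - step_integral W k \<omega>"
    using 2 by (simp add: step_integral_def)
  show "step_within t l \<Longrightarrow> step_within t k \<Longrightarrow> step_within t (l @ map (\<lambda>(c, u, v). (- c, u, v)) k)"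
    by (auto simp: step_within_def)
qed

lemma step_fun_outside: "step_within t l \<Longrightarrow> s \<notin> {0..t} \<Longrightarrow> step_fun l s = 0"
  by (induction l) (auto split: split_indicator)

lemma step_fun_measurable [measurable]: "step_fun l \<in> borel_measurable borel"
proof (induction l)
  case Nil show ?case by (simp add: step_fun_def)
next
  case (Cons p l)
  obtain c u v where "p = (c, u, v)" by (cases p) auto
  then have "step_fun (p # l) = (\<lambda>s. c * indicator {u<..v} s + step_fun l s)" by (simp add: fun_eq_iff)
  with Cons show ?case by simp
qed

lemma step_integral_measurable:
  assumes "\<And>s. s \<in> {0..t} \<Longrightarrow> W s \<in> borel_measurable F" "step_within t l"
  shows "step_integral W l \<in> borel_measurable F"
  using assms(2)
proof (induction l)
  case Nil show ?case by (simp add: step_integral_def)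
next
  case (Cons p l)
  obtain c u v where p: "p = (c, u, v)" by (cases p) auto
  then have eq: "step_integral W (p # l) = (\<lambda>\<omega>. c * (W v \<omega> - W u \<omega>) + step_integral W l \<omega>)"
    by (simp add: fun_eq_iff)
  have [measurable]: "W u \<in> borel_measurable F" "W v \<in> borel_measurable F" "step_integral W l \<in> borel_measurable F"
    using Cons p by (auto intro: assms(1))
  show ?case unfolding eq by measurable
qed

lemma step_isometry:
  assumes W: "brownian_motion M W" and l: "step_within t l" and k: "step_within t k"
  shows "(\<integral>\<^sup>+\<omega>. ennreal ((step_integral W l \<omega> - step_integral W k \<omega>)\<^sup>2) \<partial>M) =
         (\<integral>\<^sup>+s\<in>{0..t}. ennreal ((step_fun l s - step_fun k s)\<^sup>2) \<partial>lborel)"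
proof -
  define m where "m = l @ map (\<lambda>(c, u, v). (- c, u, v)) k"
  have m: "step_within t m" unfolding m_def using l k by (rule step_negate)
  obtain x where x: "has_bochner_integral M (\<lambda>\<omega>. (step_integral W m \<omega>)\<^sup>2) x"
       "has_bochner_integral lborel (\<lambda>s. (step_fun m s)\<^sup>2) x"
    using step_bilinear_isometry[OF W m m] by (auto simp: power2_eq_square)
  have "(\<integral>\<^sup>+s\<in>{0..t}. ennreal ((step_fun m s)\<^sup>2) \<partial>lborel) = (\<integral>\<^sup>+s. ennreal ((step_fun m s)\<^sup>2) \<partial>lborel)"
    by (intro nn_integral_cong) (use step_fun_outside[OF m] in \<open>auto split: split_indicator\<close>)
  also have "\<dots> = ennreal x"
    using x(2) by (subst nn_integral_eq_integral) (auto simp: has_bochner_integral_iff)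
  also have "\<dots> = (\<integral>\<^sup>+\<omega>. ennreal ((step_integral W m \<omega>)\<^sup>2) \<partial>M)"
    using x(1) by (subst nn_integral_eq_integral) (auto simp: has_bochner_integral_iff)
  finally show ?thesis unfolding m_def step_negate by simp
qed

text \<open>
  A triangle inequality for squared \<open>L\<^sup>2\<close>-distances that is also valid when they are infinite,
  so that no integrability has to be established.
\<close>

lemma nn_integral_square_triangle:
  fixes f g h :: "'b \<Rightarrow> real"
  assumes [measurable]: "f \<in> borel_measurable M" "g \<in> borel_measurable M" "h \<in> borel_measurable M"
  shows "(\<integral>\<^sup>+x. ennreal ((f x - h x)\<^sup>2) \<partial>M) \<le>
    2 * (\<integral>\<^sup>+x. ennreal ((f x - g x)\<^sup>2) \<partial>M) + 2 * (\<integral>\<^sup>+x. ennreal ((g x - h x)\<^sup>2) \<partial>M)"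
proof -
  have "(f x - h x)\<^sup>2 \<le> 2 * (f x - g x)\<^sup>2 + 2 * (g x - h x)\<^sup>2" for x
  proof -
    have "(f x - h x)\<^sup>2 + ((f x - g x) - (g x - h x))\<^sup>2 = 2 * (f x - g x)\<^sup>2 + 2 * (g x - h x)\<^sup>2"
      by (simp add: power2_eq_square algebra_simps)
    then show ?thesis using zero_le_power2[of "(f x - g x) - (g x - h x)"] by linarith
  qed
  then have "ennreal ((f x - h x)\<^sup>2) \<le> ennreal (2 * (f x - g x)\<^sup>2 + 2 * (g x - h x)\<^sup>2)" for x
    by (rule ennreal_leI)
  then have "ennreal ((f x - h x)\<^sup>2) \<le> 2 * ennreal ((f x - g x)\<^sup>2) + 2 * ennreal ((g x - h x)\<^sup>2)" for x
    by (simp add: ennreal_plus ennreal_mult)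
  then have "(\<integral>\<^sup>+x. ennreal ((f x - h x)\<^sup>2) \<partial>M) \<le>
     (\<integral>\<^sup>+x. 2 * ennreal ((f x - g x)\<^sup>2) + 2 * ennreal ((g x - h x)\<^sup>2) \<partial>M)"
    by (intro nn_integral_mono)
  also have "\<dots> = 2 * (\<integral>\<^sup>+x. ennreal ((f x - g x)\<^sup>2) \<partial>M) + 2 * (\<integral>\<^sup>+x. ennreal ((g x - h x)\<^sup>2) \<partial>M)"
    by (simp add: nn_integral_add nn_integral_cmult)
  finally show ?thesis .
qed

text \<open>
  Two sequences of step functions that approximate the same integrand are close to each other
  in \<open>L\<^sup>2(0, t)\<close>, hence by the isometry their integrals are close in \<open>L\<^sup>2(M)\<close>. This is what gives a
  meaning to the arbitrary choice made in the definition of the integral.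
\<close>

lemma has_wiener_integral_unique:
  assumes W: "brownian_motion M W"
    and J: "has_wiener_integral M W t f J" and K: "has_wiener_integral M W t f K"
  shows "AE \<omega> in M. J \<omega> = K \<omega>"
proof -
  have [measurable]: "f \<in> borel_measurable borel" "J \<in> borel_measurable M" "K \<in> borel_measurable M"
    using J K by (auto simp: has_wiener_integral_def)
  have Wm: "W s \<in> borel_measurable M" if "s \<in> {0..t}" for s
    using brownian_motion_measurable[OF W] that by auto
  obtain l where l: "\<And>n. step_within t (l n)"
    "(\<lambda>n. \<integral>\<^sup>+s\<in>{0..t}. ennreal ((f s - step_fun (l n) s)\<^sup>2) \<partial>lborel) \<longlonglongrightarrow> 0"
    "(\<lambda>n. \<integral>\<^sup>+\<omega>. ennreal ((J \<omega> - step_integral W (l n) \<omega>)\<^sup>2) \<partial>M) \<longlonglongrightarrow> 0"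
    using J unfolding has_wiener_integral_def step_within_def by blast
  obtain k where k: "\<And>n. step_within t (k n)"
    "(\<lambda>n. \<integral>\<^sup>+s\<in>{0..t}. ennreal ((f s - step_fun (k n) s)\<^sup>2) \<partial>lborel) \<longlonglongrightarrow> 0"
    "(\<lambda>n. \<integral>\<^sup>+\<omega>. ennreal ((K \<omega> - step_integral W (k n) \<omega>)\<^sup>2) \<partial>M) \<longlonglongrightarrow> 0"
    using K unfolding has_wiener_integral_def step_within_def by blast
  have [measurable]: "step_integral W (l n) \<in> borel_measurable M" "step_integral W (k n) \<in> borel_measurable M" for n
    using step_integral_measurable[OF Wm l(1)] step_integral_measurable[OF Wm k(1)] by auto
  define A where "A n = (\<integral>\<^sup>+\<omega>. ennreal ((J \<omega> - step_integral W (l n) \<omega>)\<^sup>2) \<partial>M)" for n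
  define B where "B n = (\<integral>\<^sup>+\<omega>. ennreal ((K \<omega> - step_integral W (k n) \<omega>)\<^sup>2) \<partial>M)" for n
  define C where "C n = (\<integral>\<^sup>+s\<in>{0..t}. ennreal ((f s - step_fun (l n) s)\<^sup>2) \<partial>lborel)" for n
  define D where "D n = (\<integral>\<^sup>+s\<in>{0..t}. ennreal ((f s - step_fun (k n) s)\<^sup>2) \<partial>lborel)" for n
  have "(\<integral>\<^sup>+\<omega>. ennreal ((J \<omega> - K \<omega>)\<^sup>2) \<partial>M) \<le> 2 * A n + 2 * (2 * (2 * C n + 2 * D n) + 2 * B n)" for n
  proof -
    have "(\<integral>\<^sup>+s\<in>{0..t}. ennreal ((step_fun (l n) s - step_fun (k n) s)\<^sup>2) \<partial>lborel) \<le> 2 * C n + 2 * D n"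
      using nn_integral_square_triangle[of "step_fun (l n)" "restrict_space lborel {0..t}" f "step_fun (k n)"]
      by (simp add: nn_integral_restrict_space C_def D_def measurable_restrict_space1 power2_commute)
    then have 1: "(\<integral>\<^sup>+\<omega>. ennreal ((step_integral W (l n) \<omega> - step_integral W (k n) \<omega>)\<^sup>2) \<partial>M) \<le> 2 * C n + 2 * D n"
      using step_isometry[OF W l(1) k(1)] by simp
    have "(\<integral>\<^sup>+\<omega>. ennreal ((step_integral W (l n) \<omega> - K \<omega>)\<^sup>2) \<partial>M) \<le>
        2 * (\<integral>\<^sup>+\<omega>. ennreal ((step_integral W (l n) \<omega> - step_integral W (k n) \<omega>)\<^sup>2) \<partial>M) + 2 * B n"
      using nn_integral_square_triangle[of "step_integral W (l n)" M "step_integral W (k n)" K]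
      by (simp add: B_def power2_commute[of "K _"])
    also have "\<dots> \<le> 2 * (2 * C n + 2 * D n) + 2 * B n"
      by (intro add_mono mult_left_mono 1) auto
    finally have 2: "(\<integral>\<^sup>+\<omega>. ennreal ((step_integral W (l n) \<omega> - K \<omega>)\<^sup>2) \<partial>M) \<le> 2 * (2 * C n + 2 * D n) + 2 * B n" .
    have "(\<integral>\<^sup>+\<omega>. ennreal ((J \<omega> - K \<omega>)\<^sup>2) \<partial>M) \<le>
        2 * A n + 2 * (\<integral>\<^sup>+\<omega>. ennreal ((step_integral W (l n) \<omega> - K \<omega>)\<^sup>2) \<partial>M)"
      using nn_integral_square_triangle[of J M "step_integral W (l n)" K] by (simp add: A_def)
    also have "\<dots> \<le> 2 * A n + 2 * (2 * (2 * C n + 2 * D n) + 2 * B n)"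
      by (intro add_mono mult_left_mono 2) auto
    finally show ?thesis .
  qed
  moreover have "(\<lambda>n. 2 * A n + 2 * (2 * (2 * C n + 2 * D n) + 2 * B n)) \<longlonglongrightarrow> 2 * 0 + 2 * (2 * (2 * 0 + 2 * 0) + 2 * 0)"
    using l(2,3) k(2,3)
    by (intro tendsto_intros ennreal_tendsto_cmult) (auto simp: A_def B_def C_def D_def)
  ultimately have "(\<integral>\<^sup>+\<omega>. ennreal ((J \<omega> - K \<omega>)\<^sup>2) \<partial>M) \<le> 2 * 0 + 2 * (2 * (2 * 0 + 2 * 0) + 2 * 0)"
    by (intro LIMSEQ_le_const) auto
  then have "(\<integral>\<^sup>+\<omega>. ennreal ((J \<omega> - K \<omega>)\<^sup>2) \<partial>M) \<le> 0" by simp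
  then have "AE \<omega> in M. ennreal ((J \<omega> - K \<omega>)\<^sup>2) = 0"
    by (subst (asm) le_zero_eq, subst (asm) nn_integral_0_iff_AE) auto
  then show ?thesis by (rule AE_mp) (auto intro!: AE_I2)
qed

lemma wiener_integral_eq:
  assumes W: "brownian_motion M W" and J: "has_wiener_integral M W t f J"
  shows "AE \<omega> in M. wiener_integral M W t f \<omega> = J \<omega>"
  unfolding wiener_integral_def
  by (rule has_wiener_integral_unique[OF W someI[of "has_wiener_integral M W t f", OF J] J])

text \<open>
  A single step \<open>c 1\<^bsub>(0, t]\<^esub>\<close> represents the integrand up to the null set \<open>{0}\<close>, and \<open>W\<^sub>0 = 0\<close> almost surely.
\<close>

lemma wiener_integral_const:
  assumes W: "brownian_motion M W" and t: "0 \<le> t"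
  shows "AE \<omega> in M. wiener_integral M W t (\<lambda>s. c) \<omega> = c * W t \<omega>"
proof -
  have W0: "AE \<omega> in M. W 0 \<omega> = 0" using W by (simp add: brownian_motion_def)
  have [measurable]: "W t \<in> borel_measurable M" "W 0 \<in> borel_measurable M"
    using brownian_motion_measurable[OF W] t by auto
  have 1: "(\<integral>\<^sup>+s\<in>{0..t}. ennreal ((c - step_fun [(c, 0, t)] s)\<^sup>2) \<partial>lborel) = 0"
  proof (subst nn_integral_0_iff_AE)
    show "AE s in lborel. ennreal ((c - step_fun [(c, 0, t)] s)\<^sup>2) * indicator {0..t} s = 0"
      using AE_lborel_singleton[of 0] by eventually_elim (auto split: split_indicator)
  qed measurable
  have 2: "(\<integral>\<^sup>+\<omega>. ennreal ((c * W t \<omega> - step_integral W [(c, 0, t)] \<omega>)\<^sup>2) \<partial>M) = 0"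
    using W0 by (subst nn_integral_0_iff_AE) auto
  have "has_wiener_integral M W t (\<lambda>s. c) (\<lambda>\<omega>. c * W t \<omega>)"
    unfolding has_wiener_integral_def
    by (intro conjI exI[of _ "\<lambda>n. [(c, 0, t)]"]) (use t 1 2 in auto)
  then show ?thesis by (rule wiener_integral_eq[OF W])
qed

section \<open>Time integrals of Brownian paths\<close>

text \<open>
  Compare the sum with the telescoping sum of increments of a primitive \<open>F\<close>: on each piece, the
  mean value inequality for \<open>x \<mapsto> F x - f b x\<close>, with \<open>b\<close> the right end point, bounds the error by
  the oscillation of \<open>f\<close>.
\<close>

lemma riemann_sum_tendsto:
  fixes f :: "real \<Rightarrow> real"
  assumes f: "continuous_on {0..t} f" and t: "0 < t"
  shows "(\<lambda>n. \<Sum>k<n. t / real n * f (real (Suc k) * t / real n)) \<longlonglongrightarrow> (LBINT s:{0..t}. f s)"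
proof -
  define F where "F x = integral {0..x} f" for x
  have F: "(F has_real_derivative f x) (at x within {0..t})" if "x \<in> {0..t}" for x
    using integral_has_real_derivative[OF f that] by (simp add: F_def[abs_def])
  have "set_integrable lborel {0..t} f"
    by (rule borel_integrable_atLeastAtMost') (rule f)
  then have LB: "(LBINT s:{0..t}. f s) = F t - F 0"
    using set_borel_integral_eq_integral(2)[of "{0..t}" f] by (simp add: F_def)
  show ?thesis
    unfolding LB
  proof (rule LIMSEQ_I)
    fix e :: real assume e: "0 < e"
    define e' where "e' = e / (2 * t)"
    have e': "0 < e'" using e t by (simp add: e'_def)
    have "uniformly_continuous_on {0..t} f"
      by (rule compact_uniformly_continuous[OF f]) simp
    then obtain d where d: "0 < d"
      "\<And>x y. x \<in> {0..t} \<Longrightarrow> y \<in> {0..t} \<Longrightarrow> dist y x < d \<Longrightarrow> dist (f y) (f x) < e'"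
      unfolding uniformly_continuous_on_def using e' by metis
    obtain N :: nat where N: "t / d < real N" using reals_Archimedean2 by blast
    have "norm ((\<Sum>k<n. t / real n * f (real (Suc k) * t / real n)) - (F t - F 0)) < e"
      if n: "n \<ge> Suc N" for n
    proof -
      define p where "p k = real k * t / real n" for k
      have n0: "0 < real n" using n by simp
      have "t / d < real n" using N n by linarith
      then have tn: "t / real n < d" using d(1) n0 by (simp add: field_simps)
      have step: "p (Suc k) - p k = t / real n" for k
        using n0 by (simp add: p_def field_simps)
      have piece: "norm (t / real n * f (p (Suc k)) - (F (p (Suc k)) - F (p k))) \<le> e' * (t / real n)"
        if k: "k < n" for k
      proof -
        have sub: "{p k..p (Suc k)} \<subseteq> {0..t}"
        proof -
          have "0 \<le> p k" using t by (simp add: p_def)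
          moreover have "real (Suc k) * t \<le> real n * t" using k t by (intro mult_right_mono) auto
          then have "p (Suc k) \<le> t" using n0 by (simp add: p_def divide_le_eq mult.commute)
          ultimately show ?thesis by auto
        qed
        have le: "p k \<le> p (Suc k)" using step[of k] t n0 by (smt (verit) divide_pos_pos)
        have "norm ((F (p (Suc k)) - f (p (Suc k)) * p (Suc k)) - (F (p k) - f (p (Suc k)) * p k))
            \<le> e' * norm (p (Suc k) - p k)"
        proof (rule field_differentiable_bound[where S = "{p k..p (Suc k)}" and f' = "\<lambda>x. f x - f (p (Suc k))"])
          fix x assume x: "x \<in> {p k..p (Suc k)}"
          have "(F has_real_derivative f x) (at x within {p k..p (Suc k)})"
            using F[of x] x sub by (intro DERIV_subset[OF _ sub]) auto
          then show "((\<lambda>x. F x - f (p (Suc k)) * x) has_field_derivative f x - f (p (Suc k)))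
              (at x within {p k..p (Suc k)})"
            by (auto intro!: derivative_eq_intros)
          have "dist x (p (Suc k)) < d" using x step[of k] tn by (auto simp: dist_real_def)
          then have "dist (f x) (f (p (Suc k))) < e'" using x sub le by (intro d(2)) auto
          then show "norm (f x - f (p (Suc k))) \<le> e'" by (simp add: dist_norm)
        qed (use le in auto)
        also have "norm (p (Suc k) - p k) = t / real n" using step[of k] t n0 by simp
        finally have "norm (F (p (Suc k)) - F (p k) - f (p (Suc k)) * (p (Suc k) - p k)) \<le> e' * (t / real n)"
          by (simp add: algebra_simps)
        then show ?thesis
          unfolding step by (subst norm_minus_commute) (simp add: algebra_simps)
      qed
      have "F t - F 0 = F (p n) - F (p 0)" using n0 by (simp add: p_def)
      also have "\<dots> = (\<Sum>k<n. F (p (Suc k)) - F (p k))" by (rule sum_lessThan_telescope[symmetric])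
      finally have "norm ((\<Sum>k<n. t / real n * f (p (Suc k))) - (F t - F 0)) =
          norm (\<Sum>k<n. t / real n * f (p (Suc k)) - (F (p (Suc k)) - F (p k)))"
        by (simp add: sum_subtractf)
      also have "\<dots> \<le> (\<Sum>k<n. e' * (t / real n))"
        by (rule sum_norm_le) (use piece in auto)
      also have "\<dots> = e / 2" using n0 t by (simp add: e'_def)
      also have "\<dots> < e" using e by simp
      finally show ?thesis by (simp add: p_def)
    qed
    then show "\<exists>no. \<forall>n\<ge>no. norm ((\<Sum>k<n. t / real n * f (real (Suc k) * t / real n)) - (F t - F 0)) < e"
      by blast
  qed
qed

text \<open>
  Subtracting \<open>W\<^sub>0\<close>, which vanishes only almost surely, makes the sum equal everywhere to the
  integral of a step function, see \<open>step_integral_riemann_steps\<close> below.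
\<close>

definition path_riemann_sum :: "(real \<Rightarrow> 'a \<Rightarrow> real) \<Rightarrow> real \<Rightarrow> nat \<Rightarrow> 'a \<Rightarrow> real" where
  "path_riemann_sum W t n \<omega> = (\<Sum>k<n. t / real n * (W (real (Suc k) * t / real n) \<omega> - W 0 \<omega>))"

text \<open>
  A version of \<open>\<integral>\<^sub>0\<^sup>t W\<^sub>s ds\<close>. As a limit of Riemann sums it is measurable
  with respect to the uncompleted \<open>\<sigma>\<close>-algebra of the path; the Lebesgue integral of the path need
  not be, since paths are continuous only almost surely.
\<close>

definition path_time_integral :: "(real \<Rightarrow> 'a \<Rightarrow> real) \<Rightarrow> real \<Rightarrow> 'a \<Rightarrow> real" where
  "path_time_integral W t \<omega> = lim (\<lambda>n. path_riemann_sum W t n \<omega>)"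

lemma partition_point_bounds:
  assumes "0 < t" "k < n"
  shows "0 \<le> real (Suc k) * t / real n" "real (Suc k) * t / real n \<le> t"
proof -
  show "0 \<le> real (Suc k) * t / real n" using assms by simp
  have "real (Suc k) * t \<le> real n * t" using assms by (intro mult_right_mono) auto
  then show "real (Suc k) * t / real n \<le> t" using assms by (simp add: divide_le_eq mult.commute)
qed

lemma path_riemann_sum_measurable:
  assumes W: "\<And>s. s \<in> {0..t} \<Longrightarrow> W s \<in> borel_measurable F" and t: "0 < t"
  shows "path_riemann_sum W t n \<in> borel_measurable F"
proof -
  have [measurable]: "W (real (Suc k) * t / real n) \<in> borel_measurable F" if "k < n" for k
    using partition_point_bounds[OF t that] by (intro W) auto
  have [measurable]: "W 0 \<in> borel_measurable F" using t by (intro W) auto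
  show ?thesis
    unfolding path_riemann_sum_def[abs_def]
    by (intro borel_measurable_sum borel_measurable_times borel_measurable_diff borel_measurable_const)
       (auto simp del: of_nat_Suc)
qed

lemma path_time_integral_measurable:
  assumes W: "\<And>s. s \<in> {0..t} \<Longrightarrow> W s \<in> borel_measurable F" and t: "0 < t"
  shows "path_time_integral W t \<in> borel_measurable F"
proof -
  have [measurable]: "path_riemann_sum W t n \<in> borel_measurable F" for n
    by (rule path_riemann_sum_measurable[OF W t])
  show ?thesis unfolding path_time_integral_def[abs_def] by measurable
qed

lemma path_riemann_sum_tendsto:
  assumes W: "brownian_motion M W" and t: "0 < t"
  shows "AE \<omega> in M. (\<lambda>n. path_riemann_sum W t n \<omega>) \<longlonglongrightarrow> (LBINT s:{0..t}. W s \<omega>)"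
proof -
  have "AE \<omega> in M. W 0 \<omega> = 0" "AE \<omega> in M. continuous_on {0..} (\<lambda>t. W t \<omega>)"
    using W by (auto simp: brownian_motion_def)
  then show ?thesis
  proof eventually_elim
    case (elim \<omega>)
    have "continuous_on {0..t} (\<lambda>t. W t \<omega>)" by (rule continuous_on_subset[OF elim(2)]) auto
    from riemann_sum_tendsto[OF this t] show ?case by (simp add: path_riemann_sum_def elim(1))
  qed
qed

lemma path_time_integral_eq:
  assumes W: "brownian_motion M W" and t: "0 < t"
  shows "AE \<omega> in M. path_time_integral W t \<omega> = (LBINT s:{0..t}. W s \<omega>)"
  using path_riemann_sum_tendsto[OF assms] by eventually_elim (simp add: path_time_integral_def limI)

text \<open>
  A step function approximating \<open>s \<mapsto> t - s\<close> from above: at \<open>s\<close> it counts, with weight \<open>t / n\<close>, the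
  grid points in \<open>[s, t]\<close>. The step ending at the grid point \<open>v\<close> contributes \<open>(t / n) (W\<^sub>v - W\<^sub>0)\<close> to the
  stochastic integral, which is therefore the Riemann sum of the path.
\<close>

definition riemann_steps :: "real \<Rightarrow> nat \<Rightarrow> (real \<times> real \<times> real) list" where
  "riemann_steps t n = map (\<lambda>k. (t / real n, 0, real (Suc k) * t / real n)) [0..<n]"

lemma step_within_riemann_steps: "0 < t \<Longrightarrow> step_within t (riemann_steps t n)"
  using partition_point_bounds[of t] by (fastforce simp: step_within_def riemann_steps_def)

lemma step_integral_riemann_steps: "step_integral W (riemann_steps t n) = path_riemann_sum W t n"
  by (simp add: fun_eq_iff step_integral_def riemann_steps_def path_riemann_sum_def
      interv_sum_list_conv_sum_set_nat atLeast0LessThan o_def)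

lemma step_fun_riemann_steps:
  assumes s: "0 < s" "s \<le> t" and n: "0 < n"
  shows "t - s \<le> step_fun (riemann_steps t n) s" "step_fun (riemann_steps t n) s \<le> t - s + t / real n"
proof -
  have n0: "0 < real n" and t: "0 < t" using s n by auto
  \<comment> \<open>The grid point with index \<open>k + 1\<close> is at least \<open>s\<close> exactly when \<open>p \<le> k\<close>.\<close>
  define p where "p = nat (\<lceil>real n * s / t\<rceil> - 1)"
  have pos: "0 < real n * s / t" using s n0 t by simp
  then have c1: "1 \<le> \<lceil>real n * s / t\<rceil>" by linarith
  then have p: "real p = of_int \<lceil>real n * s / t\<rceil> - 1" by (simp add: p_def)
  have le: "real n * s / t \<le> real n" using s n0 t by (simp add: divide_le_eq)
  then have "\<lceil>real n * s / t\<rceil> \<le> int n" by (simp add: ceiling_le_iff)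
  then have pn: "p \<le> n" using c1 by (simp add: p_def)
  have "indicator {0<..real (Suc k) * t / real n} s = (if p \<le> k then 1 else 0 :: real)" for k
  proof -
    have "s \<le> real (Suc k) * t / real n \<longleftrightarrow> real n * s / t \<le> real (Suc k)"
      using n0 t by (simp add: field_simps)
    also have "\<dots> \<longleftrightarrow> \<lceil>real n * s / t\<rceil> \<le> int (Suc k)" by (simp add: ceiling_le_iff)
    also have "\<dots> \<longleftrightarrow> p \<le> k" using c1 by (auto simp: p_def)
    finally show ?thesis using s by (simp add: indicator_def)
  qed
  then have "step_fun (riemann_steps t n) s = (\<Sum>k<n. t / real n * (if p \<le> k then 1 else 0))"
    by (simp add: step_fun_def riemann_steps_def interv_sum_list_conv_sum_set_nat atLeast0LessThan o_def)
  also have "\<dots> = t / real n * (\<Sum>k<n. if p \<le> k then 1 else 0)" by (simp only: sum_distrib_left)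
  also have "(\<Sum>k<n. if p \<le> k then 1 else 0 :: real) = real (card ({..<n} \<inter> {k. p \<le> k}))"
    by (simp add: sum.If_cases)
  also have "{..<n} \<inter> {k. p \<le> k} = {p..<n}" by auto
  also have "t / real n * real (card {p..<n}) = t - real p * t / real n"
    using pn n0 by (simp add: of_nat_diff field_simps)
  finally have eq: "step_fun (riemann_steps t n) s = t - real p * t / real n" .
  have "real p < real n * s / t" "real n * s / t \<le> real p + 1" unfolding p by linarith+
  then have "real p * t / real n \<le> s" "s \<le> real p * t / real n + t / real n"
    using n0 t by (simp_all add: field_simps)
  then show "t - s \<le> step_fun (riemann_steps t n) s" "step_fun (riemann_steps t n) s \<le> t - s + t / real n"
    unfolding eq by auto
qed

lemma set_nn_integral_square_le:
  fixes f :: "real \<Rightarrow> real"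
  assumes t: "0 < t" and b: "\<And>s. 0 < s \<Longrightarrow> s \<le> t \<Longrightarrow> \<bar>f s\<bar> \<le> b"
  shows "(\<integral>\<^sup>+s\<in>{0..t}. ennreal ((f s)\<^sup>2) \<partial>lborel) \<le> ennreal (b\<^sup>2 * t)"
proof -
  have "(\<integral>\<^sup>+s\<in>{0..t}. ennreal ((f s)\<^sup>2) \<partial>lborel) \<le> (\<integral>\<^sup>+s. ennreal (b\<^sup>2) * indicator {0..t} s \<partial>lborel)"
  proof (rule nn_integral_mono_AE)
    show "AE s in lborel. ennreal ((f s)\<^sup>2) * indicator {0..t} s \<le> ennreal (b\<^sup>2) * indicator {0..t} s"
      using AE_lborel_singleton[of 0]
    proof eventually_elim
      case (elim s)
      have "(f s)\<^sup>2 \<le> b\<^sup>2" if "s \<in> {0..t}"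
        using power_mono[of "\<bar>f s\<bar>" b 2] b[of s] that elim by simp
      then show ?case by (auto split: split_indicator intro!: ennreal_leI)
    qed
  qed
  also have "\<dots> = ennreal (b\<^sup>2 * t)"
    using t by (simp add: nn_integral_cmult_indicator ennreal_mult)
  finally show ?thesis .
qed

text \<open>
  The integration by parts \<open>\<integral>\<^sub>0\<^sup>t (t - s) dW\<^sub>s = \<integral>\<^sub>0\<^sup>t W\<^sub>s ds\<close>. The Riemann sums converge to the time
  integral almost surely, by continuity of the paths, and form a Cauchy sequence in \<open>L\<^sup>2\<close>, by the
  isometry; Fatou's lemma upgrades the almost sure convergence to convergence in \<open>L\<^sup>2\<close>.
\<close>

lemma has_wiener_integral_path_time_integral:
  assumes W: "brownian_motion M W" and t: "0 < t"
  shows "has_wiener_integral M W t (\<lambda>s. t - s) (path_time_integral W t)"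
proof -
  let ?J = "path_time_integral W t" and ?R = "path_riemann_sum W t"
  have Wm: "W s \<in> borel_measurable M" if "s \<in> {0..t}" for s
    using brownian_motion_measurable[OF W] that by auto
  have [measurable]: "?J \<in> borel_measurable M" "?R n \<in> borel_measurable M" for n
    using path_time_integral_measurable[OF Wm t] path_riemann_sum_measurable[OF Wm t] by auto
  have rate: "(\<lambda>n. ennreal ((c * t / real n)\<^sup>2 * t)) \<longlonglongrightarrow> 0" for c
  proof -
    have "(\<lambda>n. (c * t / real n)\<^sup>2 * t) \<longlonglongrightarrow> 0\<^sup>2 * t"
      by (intro tendsto_intros lim_const_over_n)
    from tendsto_ennrealI[OF this] show ?thesis by simp
  qed
  have f: "(\<integral>\<^sup>+s\<in>{0..t}. ennreal (((t - s) - step_fun (riemann_steps t n) s)\<^sup>2) \<partial>lborel)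
      \<le> ennreal ((1 * t / real n)\<^sup>2 * t)" if "0 < n" for n
    by (rule set_nn_integral_square_le[OF t]) (use step_fun_riemann_steps[OF _ _ that] in \<open>fastforce simp: abs_le_iff\<close>)
  have cauchy: "(\<integral>\<^sup>+\<omega>. ennreal ((?R m \<omega> - ?R n \<omega>)\<^sup>2) \<partial>M) \<le> ennreal ((2 * t / real n)\<^sup>2 * t)"
    if n: "0 < n" and m: "n \<le> m" for m n
  proof -
    have "\<bar>step_fun (riemann_steps t m) s - step_fun (riemann_steps t n) s\<bar> \<le> 2 * t / real n"
      if s: "0 < s" "s \<le> t" for s
    proof -
      have "t / real m \<le> t / real n" using n m t by (intro divide_left_mono) auto
      moreover have "0 < t / real n" using n t by simp
      ultimately show ?thesis
        using step_fun_riemann_steps[OF s, of m] step_fun_riemann_steps[OF s n] n m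
        by (simp add: abs_le_iff)
    qed
    then show ?thesis
      using step_isometry[OF W step_within_riemann_steps[OF t] step_within_riemann_steps[OF t], of m n]
      by (simp add: step_integral_riemann_steps set_nn_integral_square_le[OF t])
  qed
  have J: "(\<integral>\<^sup>+\<omega>. ennreal ((?J \<omega> - ?R n \<omega>)\<^sup>2) \<partial>M) \<le> ennreal ((2 * t / real n)\<^sup>2 * t)" if n: "0 < n" for n
  proof -
    have "AE \<omega> in M. ennreal ((?J \<omega> - ?R n \<omega>)\<^sup>2) = liminf (\<lambda>m. ennreal ((?R m \<omega> - ?R n \<omega>)\<^sup>2))"
      using path_riemann_sum_tendsto[OF W t] path_time_integral_eq[OF W t]
    proof eventually_elim
      case (elim \<omega>)
      then have "(\<lambda>m. ennreal ((?R m \<omega> - ?R n \<omega>)\<^sup>2)) \<longlonglongrightarrow> ennreal ((?J \<omega> - ?R n \<omega>)\<^sup>2)"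
        by (intro tendsto_intros) auto
      then show ?case by (intro lim_imp_Liminf[symmetric]) auto
    qed
    then have "(\<integral>\<^sup>+\<omega>. ennreal ((?J \<omega> - ?R n \<omega>)\<^sup>2) \<partial>M) =
        (\<integral>\<^sup>+\<omega>. liminf (\<lambda>m. ennreal ((?R m \<omega> - ?R n \<omega>)\<^sup>2)) \<partial>M)"
      by (rule nn_integral_cong_AE)
    also have "\<dots> \<le> liminf (\<lambda>m. \<integral>\<^sup>+\<omega>. ennreal ((?R m \<omega> - ?R n \<omega>)\<^sup>2) \<partial>M)"
      by (rule nn_integral_liminf) measurable
    also have "\<dots> \<le> limsup (\<lambda>m. \<integral>\<^sup>+\<omega>. ennreal ((?R m \<omega> - ?R n \<omega>)\<^sup>2) \<partial>M)"
      by (rule Liminf_le_Limsup) simp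
    also have "\<dots> \<le> ennreal ((2 * t / real n)\<^sup>2 * t)"
      by (rule Limsup_bounded) (use cauchy[OF n] in \<open>auto simp: eventually_sequentially\<close>)
    finally show ?thesis .
  qed
  show ?thesis
    unfolding has_wiener_integral_def
  proof (intro conjI exI[of _ "riemann_steps t"])
    show "\<forall>n. \<forall>(c, u, v)\<in>set (riemann_steps t n). 0 \<le> u \<and> u \<le> v \<and> v \<le> t"
      using step_within_riemann_steps[OF t] by (auto simp: step_within_def)
    show "(\<lambda>n. \<integral>\<^sup>+s\<in>{0..t}. ennreal (((t - s) - step_fun (riemann_steps t n) s)\<^sup>2) \<partial>lborel) \<longlonglongrightarrow> 0"
      by (rule tendsto_sandwich[OF _ _ tendsto_const rate[of 1]])
         (use f in \<open>auto simp: eventually_sequentially intro!: exI[of _ 1]\<close>)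
    show "(\<lambda>n. \<integral>\<^sup>+\<omega>. ennreal ((?J \<omega> - step_integral W (riemann_steps t n) \<omega>)\<^sup>2) \<partial>M) \<longlonglongrightarrow> 0"
      unfolding step_integral_riemann_steps
      by (rule tendsto_sandwich[OF _ _ tendsto_const rate[of 2]])
         (use J in \<open>auto simp: eventually_sequentially intro!: exI[of _ 1]\<close>)
  qed measurable
qed

section \<open>Characteristic function of a Brownian path and its time integral\<close>

lemma (in prob_space) char_normal:
  assumes X: "distributed M lborel X (normal_density 0 s)" and s: "0 < s"
  shows "char (distr M borel X) u = complex_of_real (exp (- (u\<^sup>2 * s\<^sup>2) / 2))"
proof -
  have [measurable]: "X \<in> borel_measurable M" using distributed_measurable[OF X] by simp
  have "distributed M lborel (\<lambda>\<omega>. X \<omega> / s) std_normal_density"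
    using X normal_standard_normal_convert[OF s, of X 0] by simp
  then have D: "distr M borel (\<lambda>\<omega>. X \<omega> / s) = std_normal_distribution"
    by (subst distributed_distr_eq_density[symmetric]) (auto intro!: distr_cong)
  have "char (distr M borel X) u = char (distr M borel (\<lambda>\<omega>. X \<omega> / s)) (u * s)"
    using s by (simp add: char_def integral_distr)
  also have "\<dots> = complex_of_real (exp (- (u\<^sup>2 * s\<^sup>2) / 2))"
    unfolding D char_std_normal_distribution by (simp add: power_mult_distrib)
  finally show ?thesis .
qed

text \<open>
  Rewrites a Riemann sum of a path as a combination of increments over successive time
  intervals, the ones that are independent for a Brownian motion.
\<close>

lemma sum_by_parts:
  fixes b :: "nat \<Rightarrow> real"
  shows "(\<Sum>k<n. b (Suc k) - b 0) = (\<Sum>j<n. (real n - real j) * (b (Suc j) - b j))"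
proof (induction n)
  case (Suc n)
  have "(\<Sum>j<Suc n. (real (Suc n) - real j) * (b (Suc j) - b j)) =
      (\<Sum>j<n. (real n - real j) * (b (Suc j) - b j)) + (\<Sum>j<Suc n. b (Suc j) - b j)"
    by (simp add: algebra_simps sum.distrib sum_subtractf)
  also have "(\<Sum>j<Suc n. b (Suc j) - b j) = b (Suc n) - b 0"
    by (rule sum_lessThan_telescope)
  finally show ?case using Suc by simp
qed simp

lemma path_riemann_sum_increments:
  assumes n: "0 < n"
  shows "\<alpha> * path_riemann_sum W t n \<omega> + \<beta> * (W t \<omega> - W 0 \<omega>) =
    (\<Sum>j<n. (\<alpha> * (t / real n * (real n - real j)) + \<beta>) *
       (W (real (Suc j) * t / real n) \<omega> - W (real j * t / real n) \<omega>))"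
proof -
  define b where "b j = W (real j * t / real n) \<omega>" for j
  have b: "b 0 = W 0 \<omega>" "b n = W t \<omega>" using n by (auto simp: b_def)
  have "\<alpha> * path_riemann_sum W t n \<omega> = \<alpha> * (t / real n) * (\<Sum>k<n. b (Suc k) - b 0)"
    unfolding path_riemann_sum_def b(1)[symmetric] by (simp add: b_def sum_distrib_left mult.assoc)
  also have "\<dots> = (\<Sum>j<n. \<alpha> * (t / real n * (real n - real j)) * (b (Suc j) - b j))"
    unfolding sum_by_parts sum_distrib_left mult.assoc ..
  finally have 1: "\<alpha> * path_riemann_sum W t n \<omega> =
    (\<Sum>j<n. \<alpha> * (t / real n * (real n - real j)) * (b (Suc j) - b j))" .
  have "\<beta> * (W t \<omega> - W 0 \<omega>) = \<beta> * (\<Sum>j<n. b (Suc j) - b j)"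
    by (simp only: sum_lessThan_telescope b)
  also have "\<dots> = (\<Sum>j<n. \<beta> * (b (Suc j) - b j))" by (rule sum_distrib_left)
  finally have 2: "\<beta> * (W t \<omega> - W 0 \<omega>) = (\<Sum>j<n. \<beta> * (b (Suc j) - b j))" .
  show ?thesis
    unfolding 1 2 sum.distrib[symmetric] by (simp add: b_def distrib_right)
qed

text \<open>
  In reversed order the sum is a Riemann sum of \<open>(\<alpha> s + \<beta>)\<^sup>2\<close> over \<open>[0, t]\<close>.
\<close>

lemma gaussian_variance_riemann_sum:
  fixes \<alpha> \<beta> t :: real
  assumes t: "0 < t"
  shows "(\<lambda>n. \<Sum>j<n. (\<alpha> * (t / real n * (real n - real j)) + \<beta>)\<^sup>2 * (t / real n))
    \<longlonglongrightarrow> \<alpha>\<^sup>2 * t^3 / 3 + \<alpha> * \<beta> * t\<^sup>2 + \<beta>\<^sup>2 * t"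
proof -
  have "(LBINT s:{0..t}. (\<alpha> * s + \<beta>)\<^sup>2) = \<alpha>\<^sup>2 * t^3 / 3 + \<alpha> * \<beta> * t\<^sup>2 + \<beta>\<^sup>2 * t"
  proof -
    define F where "F s = \<alpha>\<^sup>2 * s^3 / 3 + \<alpha> * \<beta> * s\<^sup>2 + \<beta>\<^sup>2 * s" for s
    have "(\<integral>s. indicator {0..t} s *\<^sub>R (\<alpha> * s + \<beta>)\<^sup>2 \<partial>lborel) = F t - F 0"
    proof (rule integral_FTC_atLeastAtMost)
      fix x
      show "(F has_vector_derivative (\<alpha> * x + \<beta>)\<^sup>2) (at x within {0..t})"
        unfolding has_real_derivative_iff_has_vector_derivative[symmetric] F_def
        by (auto intro!: derivative_eq_intros simp: power2_eq_square algebra_simps)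
    qed (use t in \<open>auto intro!: continuous_intros\<close>)
    then show ?thesis by (simp add: set_lebesgue_integral_def F_def)
  qed
  moreover have "(\<Sum>j<n. (\<alpha> * (t / real n * (real n - real j)) + \<beta>)\<^sup>2 * (t / real n)) =
      (\<Sum>k<n. t / real n * (\<alpha> * (real (Suc k) * t / real n) + \<beta>)\<^sup>2)" for n
    by (subst sum.nat_diff_reindex[symmetric])
       (intro sum.cong refl, auto simp: of_nat_diff Suc_le_eq algebra_simps)
  moreover have "continuous_on {0..t} (\<lambda>s. (\<alpha> * s + \<beta>)\<^sup>2)"
    by (intro continuous_intros)
  ultimately show ?thesis
    using riemann_sum_tendsto[of t "\<lambda>s. (\<alpha> * s + \<beta>)\<^sup>2"] t by simp
qed

lemma (in prob_space) char_path_riemann_sum: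
  assumes W: "brownian_motion M W" and t: "0 < t" and n: "0 < n"
  shows "(CLINT \<omega>|M. iexp (\<alpha> * path_riemann_sum W t n \<omega> + \<beta> * (W t \<omega> - W 0 \<omega>))) =
    complex_of_real (exp (- (\<Sum>j<n. (\<alpha> * (t / real n * (real n - real j)) + \<beta>)\<^sup>2 * (t / real n)) / 2))"
proof -
  define g where "g j = \<alpha> * (t / real n * (real n - real j)) + \<beta>" for j
  define D where "D j \<omega> = W (real (Suc j) * t / real n) \<omega> - W (real j * t / real n) \<omega>" for j \<omega>
  have lt: "real j * t / real n < real (Suc j) * t / real n" for j
    using t n by (intro divide_strict_right_mono mult_strict_right_mono) auto
  have "indep_vars (\<lambda>_. borel) D {..<n}"
    using W lt unfolding brownian_motion_def D_def[abs_def]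
    by (elim conjE) (drule spec[of _ n], drule spec[of _ "\<lambda>j. real j * t / real n"], simp)
  then have ind: "indep_vars (\<lambda>_. borel) (\<lambda>j \<omega>. g j * D j \<omega>) {..<n}"
    using indep_vars_compose2[of "\<lambda>_. borel" D "{..<n}" "\<lambda>j x. g j * x" "\<lambda>_. borel"] by simp
  have dist: "distributed M lborel (D j) (normal_density 0 (sqrt (t / real n)))" for j
  proof -
    have "real (Suc j) * t / real n - real j * t / real n = t / real n"
      by (simp add: algebra_simps add_divide_distrib)
    with brownian_motion_increment_distributed[OF W _ lt[of j]] t show ?thesis
      unfolding D_def[abs_def] by simp
  qed
  then have [measurable]: "D j \<in> borel_measurable M" for j
    using distributed_measurable[OF dist[of j]] by simp
  have ch: "char (distr M borel (\<lambda>\<omega>. g j * D j \<omega>)) 1 = complex_of_real (exp (- ((g j)\<^sup>2 * (t / real n)) / 2))" for j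
  proof -
    have "char (distr M borel (\<lambda>\<omega>. g j * D j \<omega>)) 1 = char (distr M borel (D j)) (g j)"
      by (simp add: char_def integral_distr)
    then show ?thesis using char_normal[OF dist[of j], of "g j"] t n by simp
  qed
  have "(CLINT \<omega>|M. iexp (\<alpha> * path_riemann_sum W t n \<omega> + \<beta> * (W t \<omega> - W 0 \<omega>))) =
      (CLINT \<omega>|M. iexp (\<Sum>j<n. g j * D j \<omega>))"
    unfolding path_riemann_sum_increments[OF n] g_def D_def ..
  also have "\<dots> = char (distr M borel (\<lambda>\<omega>. \<Sum>j<n. g j * D j \<omega>)) 1"
    by (subst char_def, subst integral_distr) auto
  also have "\<dots> = (\<Prod>j<n. complex_of_real (exp (- ((g j)\<^sup>2 * (t / real n)) / 2)))"
    by (subst char_distr_sum[OF ind]) (simp add: ch)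
  also have "\<dots> = complex_of_real (exp (- (\<Sum>j<n. (g j)\<^sup>2 * (t / real n)) / 2))"
    by (simp add: exp_sum sum_negf[symmetric] sum_divide_distrib flip: of_real_prod)
  finally show ?thesis by (simp add: g_def)
qed

text \<open>
  The functional \<open>\<alpha> \<integral>\<^sub>0\<^sup>t W\<^sub>s ds + \<beta> W\<^sub>t\<close> is an almost sure limit of weighted sums of independent centred
  Gaussian increments, so its characteristic function is the limit of theirs; the variance is
  \<open>\<integral>\<^sub>0\<^sup>t (\<alpha> s + \<beta>)\<^sup>2 ds\<close>.
\<close>

lemma (in prob_space) char_path_time_integral:
  assumes W: "brownian_motion M W" and t: "0 < t"
  shows "(CLINT \<omega>|M. iexp (\<alpha> * path_time_integral W t \<omega> + \<beta> * W t \<omega>)) =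
    complex_of_real (exp (- (\<alpha>\<^sup>2 * t^3 / 3 + \<alpha> * \<beta> * t\<^sup>2 + \<beta>\<^sup>2 * t) / 2))"
proof -
  let ?J = "path_time_integral W t" and ?R = "path_riemann_sum W t"
  have Wm: "W s \<in> borel_measurable M" if "s \<in> {0..t}" for s
    using brownian_motion_measurable[OF W] that by auto
  have [measurable]: "?J \<in> borel_measurable M" "?R n \<in> borel_measurable M" for n
    using path_time_integral_measurable[OF Wm t] path_riemann_sum_measurable[OF Wm t] by auto
  have [measurable]: "W 0 \<in> borel_measurable M" "W t \<in> borel_measurable M"
    using Wm t by auto
  have W0: "AE \<omega> in M. W 0 \<omega> = 0" using W by (simp add: brownian_motion_def)
  have "(\<lambda>n. CLINT \<omega>|M. iexp (\<alpha> * ?R n \<omega> + \<beta> * (W t \<omega> - W 0 \<omega>)))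
      \<longlonglongrightarrow> (CLINT \<omega>|M. iexp (\<alpha> * ?J \<omega> + \<beta> * W t \<omega>))"
  proof (rule integral_dominated_convergence[where w = "\<lambda>_. 1"])
    show "AE \<omega> in M. (\<lambda>n. iexp (\<alpha> * ?R n \<omega> + \<beta> * (W t \<omega> - W 0 \<omega>))) \<longlonglongrightarrow> iexp (\<alpha> * ?J \<omega> + \<beta> * W t \<omega>)"
      using path_riemann_sum_tendsto[OF W t] path_time_integral_eq[OF W t] W0
      by eventually_elim (auto intro!: tendsto_intros)
  qed auto
  moreover have "(\<lambda>n. complex_of_real (exp (- (\<Sum>j<n. (\<alpha> * (t / real n * (real n - real j)) + \<beta>)\<^sup>2 * (t / real n)) / 2)))
     \<longlonglongrightarrow> complex_of_real (exp (- (\<alpha>\<^sup>2 * t^3 / 3 + \<alpha> * \<beta> * t\<^sup>2 + \<beta>\<^sup>2 * t) / 2))"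
    by (intro tendsto_intros gaussian_variance_riemann_sum[OF t]) auto
  then have "(\<lambda>n. CLINT \<omega>|M. iexp (\<alpha> * ?R n \<omega> + \<beta> * (W t \<omega> - W 0 \<omega>)))
     \<longlonglongrightarrow> complex_of_real (exp (- (\<alpha>\<^sup>2 * t^3 / 3 + \<alpha> * \<beta> * t\<^sup>2 + \<beta>\<^sup>2 * t) / 2))"
    by (rule Lim_transform_eventually)
       (use char_path_riemann_sum[OF W t] in \<open>auto simp: eventually_sequentially intro!: exI[of _ 1]\<close>)
  ultimately show ?thesis by (rule LIMSEQ_unique)
qed

section \<open>Independence from characteristic functions\<close>

text \<open>
  The hypothesis says that reweighting the probability by \<open>w\<close> does not change the characteristic
  function of \<open>X\<close>; by uniqueness it does not change the law of \<open>X\<close> either. In this way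
  uniqueness on the line also yields statements about joint laws.
\<close>

lemma (in prob_space) weighted_law_eq:
  fixes w X :: "'a \<Rightarrow> real"
  assumes [measurable]: "w \<in> borel_measurable M" "X \<in> borel_measurable M" "A \<in> sets borel"
    and w: "\<And>\<omega>. 0 \<le> w \<omega>" "\<And>\<omega>. w \<omega> \<le> C"
    and ch: "\<And>s. (CLINT \<omega>|M. complex_of_real (w \<omega>) * iexp (s * X \<omega>)) =
      complex_of_real (expectation w) * char (distr M borel X) s"
  shows "expectation (\<lambda>\<omega>. w \<omega> * indicator A (X \<omega>)) = expectation w * measure (distr M borel X) A"
proof -
  define m where "m = expectation w"
  have int: "integrable M w"
    by (rule integrable_const_bound[of _ C]) (use w in auto)
  have "0 \<le> m" unfolding m_def using w by (intro integral_nonneg_AE) auto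
  then consider "m = 0" | "0 < m" by linarith
  then show ?thesis
  proof cases
    case 1
    then have "AE \<omega> in M. w \<omega> = 0"
      using integral_nonneg_eq_0_iff_AE[OF int] w by (auto simp: m_def)
    then have "expectation (\<lambda>\<omega>. w \<omega> * indicator A (X \<omega>)) = 0"
      by (intro integral_eq_zero_AE) auto
    with 1 show ?thesis by (simp add: m_def)
  next
    case 2
    define N where "N = density M (\<lambda>\<omega>. ennreal (w \<omega> / m))"
    have [measurable_cong, simp]: "sets N = sets M" "space N = space M" by (auto simp: N_def)
    have N: "prob_space N"
    proof
      have "emeasure N (space N) = (\<integral>\<^sup>+\<omega>. ennreal (w \<omega> / m) \<partial>M)"
        unfolding N_def by (subst emeasure_density) (auto intro!: nn_integral_cong)
      also have "\<dots> = ennreal (\<integral>\<omega>. w \<omega> / m \<partial>M)"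
        using int w 2 by (intro nn_integral_eq_integral) auto
      also have "(\<integral>\<omega>. w \<omega> / m \<partial>M) = 1" using 2 by (simp add: m_def)
      finally show "emeasure N (space N) = 1" by simp
    qed
    have "char (distr N borel X) = char (distr M borel X)"
    proof
      fix s
      have "char (distr N borel X) s = (CLINT \<omega>|M. complex_of_real (w \<omega>) * iexp (s * X \<omega>) / complex_of_real m)"
        using w 2 by (simp add: char_def integral_distr N_def integral_density scaleR_conv_of_real)
      also have "\<dots> = (CLINT \<omega>|M. complex_of_real (w \<omega>) * iexp (s * X \<omega>)) / complex_of_real m"
        by (rule integral_divide_zero)
      also have "\<dots> = char (distr M borel X) s"
        unfolding ch using 2 by (simp add: m_def)
      finally show "char (distr N borel X) s = char (distr M borel X) s" .
    qed
    then have eq: "distr N borel X = distr M borel X"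
      by (intro Levy_uniqueness prob_space.real_distribution_distr N real_distribution_distr) auto
    have "measure (distr N borel X) A = (\<integral>\<omega>. indicator A (X \<omega>) \<partial>N)"
    proof -
      have "measure (distr N borel X) A = measure N (X -` A \<inter> space N)"
        by (subst measure_distr) auto
      also have "\<dots> = (\<integral>\<omega>. indicator (X -` A \<inter> space N) \<omega> \<partial>N)" by simp
      also have "\<dots> = (\<integral>\<omega>. indicator A (X \<omega>) \<partial>N)"
        by (intro Bochner_Integration.integral_cong refl) (auto split: split_indicator)
      finally show ?thesis .
    qed
    also have "\<dots> = (\<integral>\<omega>. w \<omega> * indicator A (X \<omega>) / m \<partial>M)"
      using w 2 by (simp add: N_def integral_density)
    finally show ?thesis using 2 by (simp add: eq m_def field_simps)
  qed
qed

text \<open>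
  Two applications of the preceding lemma. First the weights \<open>1 + cos (u Y)\<close> and \<open>1 + sin (u Y)\<close>,
  shifted by 1 to be nonnegative, show that \<open>exp (i u Y)\<close> and the events \<open>X \<in> A\<close> are
  uncorrelated; then the weight \<open>1\<^bsub>A\<^esub>(X)\<close> shows that \<open>X \<in> A\<close> and \<open>Y \<in> B\<close> are independent.
\<close>

lemma (in prob_space) joint_law_eq_product_if_char_factorises:
  fixes X Y :: "'a \<Rightarrow> real"
  assumes [measurable]: "X \<in> borel_measurable M" "Y \<in> borel_measurable M"
    and ch: "\<And>s u. (CLINT \<omega>|M. iexp (s * X \<omega> + u * Y \<omega>)) =
      char (distr M borel X) s * char (distr M borel Y) u"
  shows "distr M borel X \<Otimes>\<^sub>M distr M borel Y = distr M (borel \<Otimes>\<^sub>M borel) (\<lambda>\<omega>. (X \<omega>, Y \<omega>))"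
proof -
  interpret X: real_distribution "distr M borel X" by simp
  interpret Y: real_distribution "distr M borel Y" by simp
  define \<phi> where "\<phi> = char (distr M borel X)"
  define \<psi> where "\<psi> = char (distr M borel Y)"
  have int: "integrable M f" if "f \<in> borel_measurable M" "\<And>\<omega>. norm (f \<omega>) \<le> 2" for f :: "'a \<Rightarrow> 'b::{banach, second_countable_topology}"
    using that by (intro integrable_const_bound[of _ 2]) auto
  have \<phi>: "(CLINT \<omega>|M. iexp (s * X \<omega>)) = \<phi> s" for s by (simp add: \<phi>_def char_def integral_distr)
  have \<psi>: "(CLINT \<omega>|M. iexp (u * Y \<omega>)) = \<psi> u" for u by (simp add: \<psi>_def char_def integral_distr)
  have joint: "(CLINT \<omega>|M. iexp (s * X \<omega> + u * Y \<omega>)) = \<phi> s * \<psi> u" for s u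
    unfolding \<phi>_def \<psi>_def by (rule ch)
  \<comment> \<open>Covers cosine and sine at once, through their expression by exponentials.\<close>
  have factor: "expectation (\<lambda>\<omega>. f (u * Y \<omega>) * indicator A (X \<omega>)) =
      expectation (\<lambda>\<omega>. f (u * Y \<omega>)) * measure (distr M borel X) A"
    if A [measurable]: "A \<in> sets borel" and f [measurable]: "f \<in> borel_measurable borel"
      and b: "\<And>x. \<bar>f x\<bar> \<le> 1"
      and fe: "\<And>x. complex_of_real (f x) = c * iexp x + d * iexp (- x)" for u A f c d
  proof -
    have fY: "complex_of_real (expectation (\<lambda>\<omega>. f (u * Y \<omega>))) = c * \<psi> u + d * \<psi> (- u)"
    proof -
      have "complex_of_real (expectation (\<lambda>\<omega>. f (u * Y \<omega>))) =
          (CLINT \<omega>|M. c * iexp (u * Y \<omega>) + d * iexp (- u * Y \<omega>))"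
        by (subst integral_complex_of_real[symmetric]) (simp only: fe mult_minus_left)
      also have "\<dots> = c * (CLINT \<omega>|M. iexp (u * Y \<omega>)) + d * (CLINT \<omega>|M. iexp (- u * Y \<omega>))"
        by (subst Bochner_Integration.integral_add) (auto intro!: int integrable_mult_right)
      finally show ?thesis by (simp only: \<psi>)
    qed
    have fXY: "(CLINT \<omega>|M. complex_of_real (f (u * Y \<omega>)) * iexp (s * X \<omega>)) = \<phi> s * (c * \<psi> u + d * \<psi> (- u))" for s
    proof -
      have "complex_of_real (f (u * Y \<omega>)) * iexp (s * X \<omega>) =
         c * iexp (s * X \<omega> + u * Y \<omega>) + d * iexp (s * X \<omega> + (- u) * Y \<omega>)" for \<omega>
        unfolding fe by (simp add: algebra_simps flip: exp_add)
      then have "(CLINT \<omega>|M. complex_of_real (f (u * Y \<omega>)) * iexp (s * X \<omega>)) =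
         (CLINT \<omega>|M. c * iexp (s * X \<omega> + u * Y \<omega>) + d * iexp (s * X \<omega> + (- u) * Y \<omega>))"
        by (simp only:)
      also have "\<dots> = c * (CLINT \<omega>|M. iexp (s * X \<omega> + u * Y \<omega>)) + d * (CLINT \<omega>|M. iexp (s * X \<omega> + (- u) * Y \<omega>))"
        by (subst Bochner_Integration.integral_add) (auto intro!: int integrable_mult_right)
      finally show ?thesis unfolding joint by (simp add: algebra_simps)
    qed
    have intf: "integrable M (\<lambda>\<omega>. f (u * Y \<omega>))"
      by (rule int) (use b in \<open>auto intro: order_trans[of _ 1]\<close>)
    have intfA: "integrable M (\<lambda>\<omega>. f (u * Y \<omega>) * indicator A (X \<omega>))"
      by (rule int) (use b in \<open>auto intro: order_trans[of _ 1] split: split_indicator\<close>)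
    have intA: "integrable M (\<lambda>\<omega>. indicator A (X \<omega>) :: real)"
      by (rule int) (auto split: split_indicator)
    have E: "expectation (\<lambda>\<omega>. 1 + f (u * Y \<omega>)) = 1 + expectation (\<lambda>\<omega>. f (u * Y \<omega>))"
      by (subst Bochner_Integration.integral_add) (auto intro: intf simp: prob_space)
    have PA: "expectation (\<lambda>\<omega>. indicator A (X \<omega>)) = measure (distr M borel X) A"
      by (subst integral_distr[of X M borel "indicator A :: real \<Rightarrow> real", symmetric]) auto
    have "expectation (\<lambda>\<omega>. (1 + f (u * Y \<omega>)) * indicator A (X \<omega>)) =
        expectation (\<lambda>\<omega>. 1 + f (u * Y \<omega>)) * measure (distr M borel X) A"
    proof (rule weighted_law_eq[where C = 2])
      fix s
      have "(CLINT \<omega>|M. complex_of_real (1 + f (u * Y \<omega>)) * iexp (s * X \<omega>)) =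
          (CLINT \<omega>|M. iexp (s * X \<omega>) + complex_of_real (f (u * Y \<omega>)) * iexp (s * X \<omega>))"
        by (simp add: distrib_right)
      also have "\<dots> = (CLINT \<omega>|M. iexp (s * X \<omega>)) + (CLINT \<omega>|M. complex_of_real (f (u * Y \<omega>)) * iexp (s * X \<omega>))"
        by (rule Bochner_Integration.integral_add)
           (use b in \<open>auto intro!: int simp: norm_mult intro: order_trans[of _ 1]\<close>)
      also have "\<dots> = complex_of_real (expectation (\<lambda>\<omega>. 1 + f (u * Y \<omega>))) * char (distr M borel X) s"
        unfolding E \<phi> fXY of_real_add fY \<phi>_def[symmetric] by (simp add: algebra_simps)
      finally show "(CLINT \<omega>|M. complex_of_real (1 + f (u * Y \<omega>)) * iexp (s * X \<omega>)) =
        complex_of_real (expectation (\<lambda>\<omega>. 1 + f (u * Y \<omega>))) * char (distr M borel X) s" .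
    next
      show "0 \<le> 1 + f (u * Y \<omega>)" "1 + f (u * Y \<omega>) \<le> 2" for \<omega>
        using b[of "u * Y \<omega>"] by (auto simp: abs_le_iff)
    qed auto
    moreover have "expectation (\<lambda>\<omega>. (1 + f (u * Y \<omega>)) * indicator A (X \<omega>)) =
       measure (distr M borel X) A + expectation (\<lambda>\<omega>. f (u * Y \<omega>) * indicator A (X \<omega>))"
      unfolding distrib_right PA[symmetric] by (subst Bochner_Integration.integral_add) (auto intro: intA intfA)
    ultimately show ?thesis unfolding E by (simp add: algebra_simps)
  qed
  have cosf: "expectation (\<lambda>\<omega>. cos (u * Y \<omega>) * indicator A (X \<omega>)) =
      expectation (\<lambda>\<omega>. cos (u * Y \<omega>)) * measure (distr M borel X) A" if "A \<in> sets borel" for u A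
    by (rule factor[of A cos "1/2" "1/2"])
       (use that in \<open>auto simp: complex_eq_iff exp_eq_polar cis.ctr Re_exp Im_exp\<close>)
  have sinf: "expectation (\<lambda>\<omega>. sin (u * Y \<omega>) * indicator A (X \<omega>)) =
      expectation (\<lambda>\<omega>. sin (u * Y \<omega>)) * measure (distr M borel X) A" if "A \<in> sets borel" for u A
    by (rule factor[of A sin "- \<i> / 2" "\<i> / 2"])
       (use that in \<open>auto simp: complex_eq_iff exp_eq_polar cis.ctr Re_exp Im_exp\<close>)
  have event: "measure (distr M (borel \<Otimes>\<^sub>M borel) (\<lambda>\<omega>. (X \<omega>, Y \<omega>))) (A \<times> B) =
      measure (distr M borel X) A * measure (distr M borel Y) B"
    if [measurable]: "A \<in> sets borel" "B \<in> sets borel" for A B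
  proof -
    have PA: "expectation (\<lambda>\<omega>. indicator A (X \<omega>)) = measure (distr M borel X) A"
      by (subst integral_distr[of X M borel "indicator A :: real \<Rightarrow> real", symmetric]) auto
    have trig2: "\<bar>cos x\<bar> \<le> 2" "\<bar>sin x\<bar> \<le> 2" for x :: real
      using abs_cos_le_one[of x] abs_sin_le_one[of x] by linarith+
    have split: "iexp x = complex_of_real (cos x) + \<i> * complex_of_real (sin x)" for x
      by (simp add: complex_eq_iff Re_exp Im_exp)
    have "expectation (\<lambda>\<omega>. indicator A (X \<omega>) * indicator B (Y \<omega>)) =
        expectation (\<lambda>\<omega>. indicator A (X \<omega>)) * measure (distr M borel Y) B"
    proof (rule weighted_law_eq[where C = 1])
      fix s
      have "(CLINT \<omega>|M. complex_of_real (indicator A (X \<omega>)) * iexp (s * Y \<omega>)) =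
          (CLINT \<omega>|M. complex_of_real (cos (s * Y \<omega>) * indicator A (X \<omega>))
            + \<i> * complex_of_real (sin (s * Y \<omega>) * indicator A (X \<omega>)))"
        unfolding split by (simp add: algebra_simps)
      also have "\<dots> = (CLINT \<omega>|M. complex_of_real (cos (s * Y \<omega>) * indicator A (X \<omega>)))
            + \<i> * (CLINT \<omega>|M. complex_of_real (sin (s * Y \<omega>) * indicator A (X \<omega>)))"
        by (subst Bochner_Integration.integral_add)
           (auto intro!: int integrable_mult_right simp: trig2 norm_mult split: split_indicator)
      also have "\<dots> = ((CLINT \<omega>|M. complex_of_real (cos (s * Y \<omega>)))
            + \<i> * (CLINT \<omega>|M. complex_of_real (sin (s * Y \<omega>)))) * measure (distr M borel X) A"
        unfolding integral_complex_of_real cosf[OF that(1)] sinf[OF that(1)] by (simp add: algebra_simps)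
      also have "(CLINT \<omega>|M. complex_of_real (cos (s * Y \<omega>))) + \<i> * (CLINT \<omega>|M. complex_of_real (sin (s * Y \<omega>)))
          = (CLINT \<omega>|M. iexp (s * Y \<omega>))"
        unfolding split
        by (subst Bochner_Integration.integral_add)
           (auto intro!: int integrable_mult_right simp: trig2 norm_mult)
      finally show "(CLINT \<omega>|M. complex_of_real (indicator A (X \<omega>)) * iexp (s * Y \<omega>)) =
        complex_of_real (expectation (\<lambda>\<omega>. indicator A (X \<omega>))) * char (distr M borel Y) s"
        unfolding \<psi> \<psi>_def PA by simp
    qed (auto split: split_indicator)
    moreover have "measure (distr M (borel \<Otimes>\<^sub>M borel) (\<lambda>\<omega>. (X \<omega>, Y \<omega>))) (A \<times> B) =
        expectation (\<lambda>\<omega>. indicator A (X \<omega>) * indicator B (Y \<omega>))"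
    proof -
      have "measure (distr M (borel \<Otimes>\<^sub>M borel) (\<lambda>\<omega>. (X \<omega>, Y \<omega>))) (A \<times> B) =
          (\<integral>p. indicator (A \<times> B) p \<partial>distr M (borel \<Otimes>\<^sub>M borel) (\<lambda>\<omega>. (X \<omega>, Y \<omega>)))"
        by simp
      also have "\<dots> = expectation (\<lambda>\<omega>. indicator (A \<times> B) (X \<omega>, Y \<omega>))"
        by (rule integral_distr) auto
      finally show ?thesis by (simp add: indicator_times)
    qed
    ultimately show ?thesis by (simp add: PA)
  qed
  interpret XY: prob_space "distr M (borel \<Otimes>\<^sub>M borel) (\<lambda>\<omega>. (X \<omega>, Y \<omega>))"
    by (rule prob_space_distr) simp
  show ?thesis
  proof (rule pair_measure_eqI)
    fix A B assume "A \<in> sets (distr M borel X)" "B \<in> sets (distr M borel Y)"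
    then have "A \<in> sets borel" "B \<in> sets borel" by auto
    from event[OF this]
    show "emeasure (distr M borel X) A * emeasure (distr M borel Y) B =
        emeasure (distr M (borel \<Otimes>\<^sub>M borel) (\<lambda>\<omega>. (X \<omega>, Y \<omega>))) (A \<times> B)"
      by (simp add: X.emeasure_eq_measure Y.emeasure_eq_measure XY.emeasure_eq_measure ennreal_mult)
  qed (auto intro!: X.sigma_finite_measure_axioms Y.sigma_finite_measure_axioms)
qed

section \<open>The joint law of a Brownian path and its time integral\<close>

text \<open>
  The vector \<open>(\<integral>\<^sub>0\<^sup>t W\<^sub>s ds, W\<^sub>t)\<close> is Gaussian with covariance matrix of rows \<open>(t\<^sup>3/3, t\<^sup>2/2)\<close> and \<open>(t\<^sup>2/2, t)\<close>.
  The residual \<open>\<integral>\<^sub>0\<^sup>t W\<^sub>s ds - (t/2) W\<^sub>t\<close> of the first component after regression on the second has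
  variance \<open>t\<^sup>3/12\<close>; normalised, the residual and \<open>W\<^sub>t\<close> are independent standard Gaussians.
\<close>

lemma (in prob_space) brownian_pair_law:
  assumes W: "brownian_motion M W" and t: "0 < t"
  shows "distr M (borel \<Otimes>\<^sub>M borel) (\<lambda>\<omega>.
      (sqrt 12 / sqrt t ^ 3 * (path_time_integral W t \<omega> - t / 2 * W t \<omega>), W t \<omega> / sqrt t)) =
    std_normal_distribution \<Otimes>\<^sub>M std_normal_distribution"
proof -
  define r q where "r = sqrt t" and "q = sqrt (12 :: real)"
  have r: "0 < r" and rt: "t = r\<^sup>2" and q: "q\<^sup>2 = 12" using t by (auto simp: r_def q_def)
  define X where "X \<omega> = q / r ^ 3 * (path_time_integral W t \<omega> - t / 2 * W t \<omega>)" for \<omega>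
  define Y where "Y \<omega> = W t \<omega> / r" for \<omega>
  have Wm: "W s \<in> borel_measurable M" if "s \<in> {0..t}" for s
    using brownian_motion_measurable[OF W] that by auto
  have [measurable]: "path_time_integral W t \<in> borel_measurable M" "W t \<in> borel_measurable M"
    using path_time_integral_measurable[OF Wm t] Wm t by auto
  have [measurable]: "X \<in> borel_measurable M" "Y \<in> borel_measurable M"
    by (simp_all add: X_def[abs_def] Y_def[abs_def])
  have joint: "(CLINT \<omega>|M. iexp (s * X \<omega> + u * Y \<omega>)) = complex_of_real (exp (- (s\<^sup>2) / 2) * exp (- (u\<^sup>2) / 2))" for s u
  proof -
    \<comment> \<open>The coefficients of the time integral and of \<open>W\<^sub>t\<close> in \<open>s X + u Y\<close>.\<close>
    define \<alpha> \<beta> where "\<alpha> = s * q / r ^ 3" and "\<beta> = (u - s * q / 2) / r"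
    have "s * X \<omega> + u * Y \<omega> = \<alpha> * path_time_integral W t \<omega> + \<beta> * W t \<omega>" for \<omega>
      using r by (simp add: X_def Y_def \<alpha>_def \<beta>_def rt field_simps power2_eq_square power3_eq_cube)
    moreover have "\<alpha>\<^sup>2 * t^3 / 3 + \<alpha> * \<beta> * t\<^sup>2 + \<beta>\<^sup>2 * t = s\<^sup>2 + u\<^sup>2"
    proof -
      have "\<alpha>\<^sup>2 * t^3 = s\<^sup>2 * q\<^sup>2" using r
        by (simp add: \<alpha>_def rt power_mult_distrib power_divide flip: power_mult)
      moreover have "\<alpha> * \<beta> * t\<^sup>2 = s * q * (u - s * q / 2)" using r
        by (simp add: \<alpha>_def \<beta>_def rt power_mult_distrib power_divide power2_eq_square power3_eq_cube field_simps)
      moreover have "\<beta>\<^sup>2 * t = (u - s * q / 2)\<^sup>2" using r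
        by (simp add: \<beta>_def rt power_mult_distrib power_divide)
      moreover have "s\<^sup>2 * q\<^sup>2 / 3 + s * q * (u - s * q / 2) + (u - s * q / 2)\<^sup>2 = s\<^sup>2 * q\<^sup>2 / 12 + u\<^sup>2"
        by (simp add: power2_eq_square algebra_simps)
      ultimately show ?thesis using q by simp
    qed
    ultimately show ?thesis
      using char_path_time_integral[OF W t, of \<alpha> \<beta>] by (simp add: add_divide_distrib flip: exp_add)
  qed
  have X: "distr M borel X = std_normal_distribution"
  proof (rule Levy_uniqueness)
    show "char (distr M borel X) = char std_normal_distribution"
    proof
      fix s
      have "char (distr M borel X) s = (CLINT \<omega>|M. iexp (s * X \<omega> + 0 * Y \<omega>))"
        by (simp add: char_def integral_distr)
      then show "char (distr M borel X) s = char std_normal_distribution s"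
        unfolding joint by (simp add: char_std_normal_distribution)
    qed
  qed (auto intro: real_dist_normal_dist)
  have Y: "distr M borel Y = std_normal_distribution"
  proof (rule Levy_uniqueness)
    show "char (distr M borel Y) = char std_normal_distribution"
    proof
      fix u
      have "char (distr M borel Y) u = (CLINT \<omega>|M. iexp (0 * X \<omega> + u * Y \<omega>))"
        by (simp add: char_def integral_distr)
      then show "char (distr M borel Y) u = char std_normal_distribution u"
        unfolding joint by (simp add: char_std_normal_distribution)
    qed
  qed (auto intro: real_dist_normal_dist)
  have "distr M borel X \<Otimes>\<^sub>M distr M borel Y = distr M (borel \<Otimes>\<^sub>M borel) (\<lambda>\<omega>. (X \<omega>, Y \<omega>))"
  proof (rule joint_law_eq_product_if_char_factorises)
    show "(CLINT \<omega>|M. iexp (s * X \<omega> + u * Y \<omega>)) = char (distr M borel X) s * char (distr M borel Y) u" for s u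
      unfolding joint X Y by (simp add: char_std_normal_distribution)
  qed auto
  then show ?thesis unfolding X Y by (simp add: X_def Y_def r_def q_def)
qed

section \<open>The image of a Gaussian pair under a triangular map\<close>

lemma vector_2_eq: "(vector [x, y] :: real^2) = x *\<^sub>R axis 1 1 + y *\<^sub>R axis 2 1"
  by (simp add: vec_eq_iff forall_2 axis_def)

lemma measurable_vector_2 [measurable (raw)]:
  fixes f g :: "'a \<Rightarrow> real"
  assumes [measurable]: "f \<in> borel_measurable M" "g \<in> borel_measurable M"
  shows "(\<lambda>x. vector [f x, g x] :: real^2) \<in> borel_measurable M"
  unfolding vector_2_eq by measurable

text \<open>
  Transports Fubini's theorem from the product of two lines to \<open>real^2\<close>, whose Lebesgue measure is
  not defined as a binary product.
\<close>

lemma lborel_vector_2: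
  "(lborel :: (real^2) measure) = distr (lborel \<Otimes>\<^sub>M lborel) borel (\<lambda>(x, y). vector [x, y])"
proof (rule lborel_eqI)
  fix l u :: "real^2"
  assume le: "\<And>b. b \<in> Basis \<Longrightarrow> l \<bullet> b \<le> u \<bullet> b"
  have B: "(Basis :: (real^2) set) = {axis 1 1, axis 2 1}"
    by (auto simp: Basis_vec_def UNIV_2)
  have le12: "l $ 1 \<le> u $ 1" "l $ 2 \<le> u $ 2"
    using le[of "axis 1 1"] le[of "axis 2 1"] by (auto simp: B inner_axis)
  have "(\<lambda>(x, y). vector [x, y]) -` box l u = {l $ 1<..<u $ 1} \<times> {l $ 2<..<u $ 2}"
    by (auto simp: mem_box_cart forall_2)
  then have "emeasure (distr (lborel \<Otimes>\<^sub>M lborel) borel (\<lambda>(x, y). vector [x, y])) (box l u) =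
      emeasure (lborel \<Otimes>\<^sub>M lborel) ({l $ 1<..<u $ 1} \<times> {l $ 2<..<u $ 2})"
    by (subst emeasure_distr) (auto simp: space_pair_measure)
  also have "\<dots> = ennreal ((u $ 1 - l $ 1) * (u $ 2 - l $ 2))"
    using le12 by (simp add: lborel.emeasure_pair_measure_Times ennreal_mult)
  also have "(u $ 1 - l $ 1) * (u $ 2 - l $ 2) = (\<Prod>b\<in>Basis. (u - l) \<bullet> b)"
    by (simp add: B axis_eq_axis inner_axis inner_diff_left)
  finally show "emeasure (distr (lborel \<Otimes>\<^sub>M lborel) borel (\<lambda>(x, y). vector [x, y])) (box l u) =
      ennreal (\<Prod>b\<in>Basis. (u - l) \<bullet> b)" .
qed simp

text \<open>
  The density of \<open>(p x + q y, r y)\<close> for independent standard Gaussians \<open>x\<close> and \<open>y\<close>, obtained by solving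
  for \<open>x\<close> and \<open>y\<close> and dividing by the determinant \<open>p r\<close>.
\<close>

definition triangular_gauss_density :: "real \<Rightarrow> real \<Rightarrow> real \<Rightarrow> real^2 \<Rightarrow> real" where
  "triangular_gauss_density p q r w =
     std_normal_density ((w $ 1 - q * (w $ 2 / r)) / p) * std_normal_density (w $ 2 / r) / (p * r)"

lemma triangular_gauss_density_measurable [measurable]:
  "triangular_gauss_density p q r \<in> borel_measurable borel"
  unfolding triangular_gauss_density_def[abs_def] by measurable

lemma triangular_gauss_density_nonneg:
  "0 < p \<Longrightarrow> 0 < r \<Longrightarrow> 0 \<le> triangular_gauss_density p q r w"
  by (simp add: triangular_gauss_density_def)

text \<open>
  Change of variables: since the map is triangular, it can be inverted one coordinate at a time
  under Fubini's theorem, first \<open>y\<close> and then \<open>x\<close> for fixed \<open>y\<close>.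
\<close>

lemma triangular_gauss_law:
  fixes p q r :: real and m :: "real^2"
  assumes p: "0 < p" and r: "0 < r"
  shows "distr (std_normal_distribution \<Otimes>\<^sub>M std_normal_distribution) borel
      (\<lambda>(x, y). m + vector [p * x + q * y, r * y]) =
    density lborel (\<lambda>z. ennreal (triangular_gauss_density p q r (z - m)))" (is "?L = ?R")
proof (rule measure_eqI)
  let ?g = "\<lambda>x. ennreal (std_normal_density x)"
  interpret N: prob_space std_normal_distribution by (rule prob_space_normal_density) simp
  have pair: "std_normal_distribution \<Otimes>\<^sub>M std_normal_distribution =
      density (lborel \<Otimes>\<^sub>M lborel) (\<lambda>(x, y). ?g x * ?g y)"
    by (rule pair_measure_density) (auto intro: N.sigma_finite_measure_axioms lborel.sigma_finite_measure_axioms)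
  fix A assume "A \<in> sets ?L"
  then have A [measurable]: "A \<in> sets borel" by simp
  let ?h = "\<lambda>x y. m + vector [p * x + q * y, r * y]"
  have "emeasure ?L A = (\<integral>\<^sup>+z. indicator A z \<partial>?L)" by simp
  also have "\<dots> = (\<integral>\<^sup>+v. indicator A (case v of (x, y) \<Rightarrow> ?h x y)
      \<partial>(std_normal_distribution \<Otimes>\<^sub>M std_normal_distribution))"
    by (rule nn_integral_distr) (auto simp: measurable_split_conv)
  also have "\<dots> = (\<integral>\<^sup>+v. (case v of (x, y) \<Rightarrow> ?g x * ?g y * indicator A (?h x y)) \<partial>(lborel \<Otimes>\<^sub>M lborel))"
    unfolding pair by (subst nn_integral_density) (auto simp: split_beta')
  also have "\<dots> = (\<integral>\<^sup>+y. \<integral>\<^sup>+x. ?g x * ?g y * indicator A (?h x y) \<partial>lborel \<partial>lborel)"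
    by (subst lborel_pair.nn_integral_snd[symmetric]) auto
  finally have L: "emeasure ?L A = (\<integral>\<^sup>+y. \<integral>\<^sup>+x. ?g x * ?g y * indicator A (?h x y) \<partial>lborel \<partial>lborel)" .

  let ?f = "\<lambda>z. ennreal (triangular_gauss_density p q r (z - m)) * indicator A z"
  have "emeasure ?R A = (\<integral>\<^sup>+z. ?f z \<partial>lborel)"
    by (subst emeasure_density) auto
  also have "\<dots> = (\<integral>\<^sup>+v. ?f (case v of (x, y) \<Rightarrow> vector [x, y]) \<partial>(lborel \<Otimes>\<^sub>M lborel))"
    by (subst lborel_vector_2, subst nn_integral_distr) (auto simp: measurable_split_conv)
  also have "\<dots> = (\<integral>\<^sup>+y. \<integral>\<^sup>+x. ?f (vector [x, y]) \<partial>lborel \<partial>lborel)"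
    by (subst lborel_pair.nn_integral_snd[symmetric]) auto
  also have "\<dots> = ennreal \<bar>r\<bar> * (\<integral>\<^sup>+y. \<integral>\<^sup>+x. ?f (vector [x, m $ 2 + r * y]) \<partial>lborel \<partial>lborel)"
    using r by (intro nn_integral_real_affine) auto
  also have "\<dots> = ennreal r * (\<integral>\<^sup>+y. ennreal p * (\<integral>\<^sup>+x. ?f (vector [(m $ 1 + q * y) + p * x, m $ 2 + r * y]) \<partial>lborel) \<partial>lborel)"
  proof -
    have "(\<integral>\<^sup>+x. ?f (vector [x, m $ 2 + r * y]) \<partial>lborel) =
      ennreal \<bar>p\<bar> * (\<integral>\<^sup>+x. ?f (vector [(m $ 1 + q * y) + p * x, m $ 2 + r * y]) \<partial>lborel)" for y
      using p by (intro nn_integral_real_affine) auto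
    then show ?thesis using p r by simp
  qed
  also have "\<dots> = (\<integral>\<^sup>+y. \<integral>\<^sup>+x. ennreal r * (ennreal p * ?f (vector [(m $ 1 + q * y) + p * x, m $ 2 + r * y])) \<partial>lborel \<partial>lborel)"
    by (simp add: nn_integral_cmult)
  also have "\<dots> = (\<integral>\<^sup>+y. \<integral>\<^sup>+x. ?g x * ?g y * indicator A (?h x y) \<partial>lborel \<partial>lborel)"
  proof (intro nn_integral_cong)
    fix x y
    let ?z = "vector [(m $ 1 + q * y) + p * x, m $ 2 + r * y] :: real^2"
    have z: "?z = ?h x y" by (simp add: vec_eq_iff forall_2)
    have "triangular_gauss_density p q r (?h x y - m) = std_normal_density x * std_normal_density y / (p * r)"
      using p r by (simp add: triangular_gauss_density_def)
    then have "ennreal r * (ennreal p * ennreal (triangular_gauss_density p q r (?h x y - m))) = ?g x * ?g y"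
      using p r by (simp flip: ennreal_mult)
    then show "ennreal r * (ennreal p * ?f ?z) = ?g x * ?g y * indicator A (?h x y)"
      unfolding z by (simp add: mult.assoc[symmetric])
  qed
  finally show "emeasure ?L A = emeasure ?R A" using L by simp
qed simp

lemma matrix_inv_unique:
  fixes A :: "real^'n^'n"
  assumes "A ** B = mat 1" "B ** A = mat 1"
  shows "matrix_inv A = B"
proof -
  have "\<exists>X. A ** X = mat 1 \<and> X ** A = mat 1" using assms by blast
  then have "A ** matrix_inv A = mat 1 \<and> matrix_inv A ** A = mat 1"
    unfolding matrix_inv_def by (rule someI_ex)
  then have "matrix_inv A ** (A ** B) = B" by (simp add: matrix_mul_assoc)
  then show ?thesis by (simp add: assms(1))
qed

text \<open>
  The triangular matrix with rows \<open>(p, q)\<close> and \<open>(0, r)\<close>, with the arguments on the right as its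
  entries, is a square root of the covariance: times its transpose it gives \<open>\<C>\<^sub>t\<close>. Completing
  the square in the quadratic form of \<open>\<C>\<^sub>t\<^sup>-\<^sup>1\<close> therefore produces the product of two
  one-dimensional densities.
\<close>

lemma langevin_fundamental_solution_eq:
  assumes a: "\<sigma>\<^sup>2 < a" and t: "0 < t"
  defines "c \<equiv> sqrt (a - \<sigma>\<^sup>2)"
  shows "langevin_fundamental_solution M W a \<sigma> t z \<zeta> \<omega> =
    triangular_gauss_density (c * sqrt t ^ 3 / sqrt 12) (c * sqrt t ^ 3 / 2) (c * sqrt t)
      (z - langevin_mean M W \<sigma> t \<zeta> \<omega>)"
proof -
  define w where "w = z - langevin_mean M W \<sigma> t \<zeta> \<omega>"
  define r q where "r = sqrt t" and "q = sqrt (12 :: real)"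
  have r: "0 < r" "t = r\<^sup>2" and q: "0 < q" "q\<^sup>2 = 12" using t by (auto simp: r_def q_def)
  have c: "0 < c" "a - \<sigma>\<^sup>2 = c\<^sup>2" using a by (auto simp: c_def)
  define k where "k = c\<^sup>2"
  have k: "0 < k" using c by (simp add: k_def)
  define C where "C = langevin_cov a \<sigma> t"
  have C: "C $ 1 $ 1 = k * (t ^ 3 / 3)" "C $ 1 $ 2 = k * (t\<^sup>2 / 2)"
      "C $ 2 $ 1 = k * (t\<^sup>2 / 2)" "C $ 2 $ 2 = k * t"
    by (simp_all add: C_def langevin_cov_def c(2) k_def)
  define D :: "real^2^2" where "D = vector [vector [12 / (k * t ^ 3), - 6 / (k * t\<^sup>2)],
      vector [- 6 / (k * t\<^sup>2), 4 / (k * t)]]"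
  have D: "D $ 1 $ 1 = 12 / (k * t ^ 3)" "D $ 1 $ 2 = - 6 / (k * t\<^sup>2)"
      "D $ 2 $ 1 = - 6 / (k * t\<^sup>2)" "D $ 2 $ 2 = 4 / (k * t)"
    by (simp_all add: D_def)
  have "k * (t ^ 3 / 3) * (12 / (k * t ^ 3)) + k * (t\<^sup>2 / 2) * (- 6 / (k * t\<^sup>2)) = 1"
      "k * (t ^ 3 / 3) * (- 6 / (k * t\<^sup>2)) + k * (t\<^sup>2 / 2) * (4 / (k * t)) = 0"
      "k * (t\<^sup>2 / 2) * (12 / (k * t ^ 3)) + k * t * (- 6 / (k * t\<^sup>2)) = 0"
      "k * (t\<^sup>2 / 2) * (- 6 / (k * t\<^sup>2)) + k * t * (4 / (k * t)) = 1"
    using k t by (simp_all add: power2_eq_square power3_eq_cube)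
  then have "C ** D = mat 1" "D ** C = mat 1"
    unfolding matrix_matrix_mult_def mat_def vec_eq_iff forall_2 sum_2 vec_lambda_beta C D
    by (simp_all add: mult.commute)
  then have inv: "matrix_inv C = D" by (rule matrix_inv_unique)
  have "det C = (k * t\<^sup>2)\<^sup>2 / 12"
    unfolding det_2 C by (simp add: power2_eq_square power3_eq_cube)
  also have "\<dots> = (k * t\<^sup>2 / q)\<^sup>2"
    unfolding power_divide q(2) ..
  finally have det: "sqrt (det C) = k * t\<^sup>2 / q" using k q by simp
  have quad: "(D *v w) \<bullet> w = 12 / (k * t ^ 3) * (w $ 1)\<^sup>2 - 12 / (k * t\<^sup>2) * (w $ 1 * w $ 2) + 4 / (k * t) * (w $ 2)\<^sup>2"
    by (simp add: matrix_vector_mult_def inner_vec_def sum_2 D power2_eq_square algebra_simps)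
  have cr: "(c * r ^ 3)\<^sup>2 = k * t ^ 3" "(c * r)\<^sup>2 = k * t"
    by (simp_all add: k_def r(2) power_mult_distrib flip: power_mult)
  have "(w $ 1 - c * r ^ 3 / 2 * (w $ 2 / (c * r))) / (c * r ^ 3 / q) = q * (w $ 1 - t / 2 * w $ 2) / (c * r ^ 3)"
    using c(1) r(1) q(1) unfolding r(2) by (simp add: power2_eq_square power3_eq_cube)
  moreover have "(q * (w $ 1 - t / 2 * w $ 2) / (c * r ^ 3))\<^sup>2 = 12 * (w $ 1 - t / 2 * w $ 2)\<^sup>2 / (k * t ^ 3)"
    by (simp only: power_divide cr power_mult_distrib[of q] q(2))
  moreover have "(w $ 2 / (c * r))\<^sup>2 = (w $ 2)\<^sup>2 / (k * t)"
    by (simp only: power_divide cr)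
  ultimately have "((w $ 1 - c * r ^ 3 / 2 * (w $ 2 / (c * r))) / (c * r ^ 3 / q))\<^sup>2 + (w $ 2 / (c * r))\<^sup>2
      = 12 * (w $ 1 - t / 2 * w $ 2)\<^sup>2 / (k * t ^ 3) + (w $ 2)\<^sup>2 / (k * t)"
    by (simp only:)
  also have "\<dots> = (D *v w) \<bullet> w"
  proof -
    have e: "12 * (x - t / 2 * y)\<^sup>2 = 12 * x\<^sup>2 - 12 * (x * y) * t + 3 * y\<^sup>2 * t\<^sup>2" for x y
      by (simp add: power2_eq_square algebra_simps)
    have f: "t / (k * t ^ 3) = 1 / (k * t\<^sup>2)" "t\<^sup>2 / (k * t ^ 3) = 1 / (k * t)"
      using k t by (simp_all add: power2_eq_square power3_eq_cube)
    show ?thesis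
      unfolding quad e add_divide_distrib diff_divide_distrib times_divide_eq_right[symmetric] f
      by (simp add: algebra_simps)
  qed
  finally have sq: "((w $ 1 - c * r ^ 3 / 2 * (w $ 2 / (c * r))) / (c * r ^ 3 / q))\<^sup>2 + (w $ 2 / (c * r))\<^sup>2
     = (D *v w) \<bullet> w" .
  have std: "std_normal_density x * std_normal_density y = 1 / (2 * pi) * exp (- (1/2) * (x\<^sup>2 + y\<^sup>2))" for x y
    by (simp add: std_normal_density_def real_sqrt_mult[symmetric] field_simps flip: exp_add)
  have pr: "c * r ^ 3 / q * (c * r) = k * t\<^sup>2 / q"
    unfolding k_def r(2) by (simp add: power2_eq_square power3_eq_cube)
  have "triangular_gauss_density (c * r ^ 3 / q) (c * r ^ 3 / 2) (c * r) w =
      1 / (2 * pi) * exp (- (1/2) * ((D *v w) \<bullet> w)) / (k * t\<^sup>2 / q)"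
    unfolding triangular_gauss_density_def std sq pr ..
  also have "\<dots> = langevin_fundamental_solution M W a \<sigma> t z \<zeta> \<omega>"
    unfolding langevin_fundamental_solution_def C_def[symmetric] inv det w_def[symmetric] by simp
  finally show ?thesis by (simp add: w_def r_def q_def)
qed

section \<open>Conditioning on an independent filtration\<close>

text \<open>
  Independence makes the law of \<open>(\<omega>, G \<omega>)\<close> on \<open>F \<Otimes>\<^sub>M N\<close> a product measure, where the first factor is
  the identity map read as a random element with values in the \<open>\<sigma>\<close>-algebra \<open>F\<close>. Fubini's theorem for this
  product measure is the defining identity of the conditional expectation.
\<close>

lemma (in prob_space) real_cond_exp_freezing:
  fixes \<psi> :: "'a \<times> 'b \<Rightarrow> real"
  assumes F: "subalgebra M F" and G [measurable]: "G \<in> measurable M N"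
    and ind: "indep_set (sets F) {G -` B \<inter> space M | B. B \<in> sets N}"
    and \<psi> [measurable]: "\<psi> \<in> borel_measurable (F \<Otimes>\<^sub>M N)" and b: "\<And>v. \<bar>\<psi> v\<bar> \<le> C"
  shows "AE \<omega> in M. real_cond_exp M F (\<lambda>\<omega>. \<psi> (\<omega>, G \<omega>)) \<omega> = (\<integral>g. \<psi> (\<omega>, g) \<partial>distr M N G)"
proof -
  interpret F: finite_measure_subalgebra M F
    by (intro finite_measure_subalgebra.intro finite_measure_axioms finite_measure_subalgebra_axioms.intro F)
  have rv [measurable]: "(\<lambda>\<omega>. \<omega>) \<in> measurable M F"
    by (rule measurable_from_subalg[OF F]) simp
  interpret DF: prob_space "distr M F (\<lambda>\<omega>. \<omega>)" by (rule prob_space_distr) simp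
  interpret DG: prob_space "distr M N G" by (rule prob_space_distr) simp
  have pair: "distr M F (\<lambda>\<omega>. \<omega>) \<Otimes>\<^sub>M distr M N G = distr M (F \<Otimes>\<^sub>M N) (\<lambda>\<omega>. (\<omega>, G \<omega>))"
  proof (rule pair_measure_eqI)
    fix A B assume "A \<in> sets (distr M F (\<lambda>\<omega>. \<omega>))" "B \<in> sets (distr M N G)"
    then have AB [measurable]: "A \<in> sets F" "B \<in> sets N" by auto
    have A: "A \<subseteq> space M" using sets.sets_into_space[OF AB(1)] F by (simp add: subalgebra_def)
    have eqs: "(\<lambda>\<omega>. (\<omega>, G \<omega>)) -` (A \<times> B) \<inter> space M = A \<inter> (G -` B \<inter> space M)" by auto
    have "prob (A \<inter> (G -` B \<inter> space M)) = prob A * prob (G -` B \<inter> space M)"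
      by (rule indep_setD[OF ind]) (use AB in auto)
    then show "emeasure (distr M F (\<lambda>\<omega>. \<omega>)) A * emeasure (distr M N G) B =
        emeasure (distr M (F \<Otimes>\<^sub>M N) (\<lambda>\<omega>. (\<omega>, G \<omega>))) (A \<times> B)"
      by (simp add: emeasure_distr eqs Int_absorb2[OF A] emeasure_eq_measure ennreal_mult)
  qed (auto intro: DF.sigma_finite_measure_axioms DG.sigma_finite_measure_axioms)
  interpret P: pair_prob_space "distr M F (\<lambda>\<omega>. \<omega>)" "distr M N G" ..
  \<comment> \<open>The candidate for the conditional expectation.\<close>
  define \<Psi> where "\<Psi> \<omega> = (\<integral>g. \<psi> (\<omega>, g) \<partial>distr M N G)" for \<omega>
  have \<Psi> [measurable]: "\<Psi> \<in> borel_measurable F"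
    unfolding \<Psi>_def[abs_def] by measurable
  have C: "0 \<le> C" using b[of undefined] by linarith
  have \<Psi>b: "\<bar>\<Psi> \<omega>\<bar> \<le> C" if "\<omega> \<in> space F" for \<omega>
  proof -
    have [measurable]: "(\<lambda>g. \<psi> (\<omega>, g)) \<in> borel_measurable N" using that by measurable
    have "\<bar>\<Psi> \<omega>\<bar> \<le> (\<integral>g. \<bar>\<psi> (\<omega>, g)\<bar> \<partial>distr M N G)"
      unfolding \<Psi>_def by (rule integral_abs_bound)
    also have "\<dots> \<le> (\<integral>g. C \<partial>distr M N G)"
      by (intro integral_mono DG.integrable_const_bound[of _ C]) (use b C in auto)
    finally show ?thesis using DG.prob_space by simp
  qed
  have [measurable]: "\<Psi> \<in> borel_measurable M" using measurable_compose[OF rv \<Psi>] by simp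
  show ?thesis
    unfolding \<Psi>_def[symmetric]
  proof (rule F.real_cond_exp_charact)
    show "integrable M (\<lambda>\<omega>. \<psi> (\<omega>, G \<omega>))"
      by (rule integrable_const_bound[of _ C]) (use b in auto)
    show "integrable M \<Psi>"
      by (rule integrable_const_bound[of _ C])
         (use \<Psi>b measurable_space[OF rv] in \<open>auto intro!: AE_I2\<close>)
    fix A assume A [measurable]: "A \<in> sets F"
    let ?f = "\<lambda>v. indicator A (fst v) * \<psi> v :: real"
    have "(\<integral>\<omega>\<in>A. \<psi> (\<omega>, G \<omega>) \<partial>M) = (\<integral>\<omega>. ?f (\<omega>, G \<omega>) \<partial>M)"
      by (simp add: set_lebesgue_integral_def)
    also have "\<dots> = (\<integral>v. ?f v \<partial>(distr M F (\<lambda>\<omega>. \<omega>) \<Otimes>\<^sub>M distr M N G))"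
      unfolding pair by (subst integral_distr) auto
    also have "\<dots> = (\<integral>\<omega>. \<integral>g. ?f (\<omega>, g) \<partial>distr M N G \<partial>distr M F (\<lambda>\<omega>. \<omega>))"
    proof (rule P.integral_fst'[symmetric])
      show "integrable (distr M F (\<lambda>\<omega>. \<omega>) \<Otimes>\<^sub>M distr M N G) ?f"
        by (rule P.integrable_const_bound[of _ C]) (use b C in \<open>auto split: split_indicator\<close>)
    qed
    also have "\<dots> = (\<integral>\<omega>. indicator A \<omega> * \<Psi> \<omega> \<partial>M)"
      by (subst integral_distr) (auto simp: \<Psi>_def)
    finally show "(\<integral>\<omega>\<in>A. \<psi> (\<omega>, G \<omega>) \<partial>M) = (\<integral>\<omega>\<in>A. \<Psi> \<omega> \<partial>M)"
      by (simp add: set_lebesgue_integral_def)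
  qed (rule \<Psi>)
qed

lemma space_process_algebra [simp]: "space (process_algebra M Y T) = space M"
  by (simp add: process_algebra_def space_measure_of_conv)

lemma sets_process_algebra:
  "sets (process_algebra M Y T) = sigma_sets (space M) {Y s -` A \<inter> space M | s A. s \<in> T \<and> A \<in> sets borel}"
  unfolding process_algebra_def by (rule sets_measure_of) auto

lemma measurable_process_algebra: "s \<in> T \<Longrightarrow> Y s \<in> borel_measurable (process_algebra M Y T)"
  by (rule measurableI) (auto simp: sets_process_algebra intro!: sigma_sets.Basic)

lemma subalgebra_natural_filtration:
  assumes "\<And>s. 0 \<le> s \<Longrightarrow> Y s \<in> borel_measurable M"
  shows "subalgebra M (natural_filtration M Y t)"
  unfolding subalgebra_def natural_filtration_def sets_process_algebra
  using assms by (auto intro!: sets.sigma_sets_subset measurable_sets)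

lemma sets_natural_filtration_subset:
  "sets (natural_filtration M Y t) \<subseteq> sets (process_algebra M Y {0..})"
  unfolding natural_filtration_def sets_process_algebra by (intro sigma_sets_mono') auto

lemma (in prob_space) indep_processes_filtration:
  assumes ind: "indep_processes M B W" and G: "G \<in> measurable (process_algebra M B {0..}) N"
  shows "indep_set (sets (natural_filtration M W t)) {G -` A \<inter> space M | A. A \<in> sets N}"
proof -
  have I: "indep_set (sets (process_algebra M B {0..})) (sets (process_algebra M W {0..}))"
    using ind by (simp add: indep_processes_def)
  have sub: "{G -` A \<inter> space M | A. A \<in> sets N} \<subseteq> sets (process_algebra M B {0..})"
    using measurable_sets[OF G] by auto
  show ?thesis
    unfolding indep_sets2_eq
  proof (intro conjI ballI)
    show "sets (natural_filtration M W t) \<subseteq> events"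
      using sets_natural_filtration_subset indep_setD_ev2[OF I] by (rule subset_trans)
    show "{G -` A \<inter> space M | A. A \<in> sets N} \<subseteq> events"
      using sub indep_setD_ev1[OF I] by (rule subset_trans)
    fix a b assume "a \<in> sets (natural_filtration M W t)" "b \<in> {G -` A \<inter> space M | A. A \<in> sets N}"
    then have "prob (b \<inter> a) = prob b * prob a"
      using sub sets_natural_filtration_subset[of M W t] by (intro indep_setD[OF I]) blast+
    then show "prob (a \<inter> b) = prob a * prob b" by (simp add: Int_commute mult.commute)
  qed
qed

section \<open>The Langevin equation\<close>

text \<open>
  The velocity is known only almost surely at each separate time; together with continuity
  of the paths this lemma gives it almost surely at all times simultaneously.
\<close>

lemma continuous_on_nonneg_eq_of_rationals:
  fixes f g :: "real \<Rightarrow> real"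
  assumes f: "continuous_on {0..} f" and g: "continuous_on {0..} g"
    and eq: "\<And>x. x \<in> \<rat> \<Longrightarrow> 0 \<le> x \<Longrightarrow> f x = g x" and s: "0 \<le> s"
  shows "f s = g s"
proof -
  have "\<exists>x. x \<in> \<rat> \<and> s < x \<and> x < s + 1 / real (Suc n)" for n
    using Rats_dense_in_real[of s "s + 1 / real (Suc n)"] by auto
  then obtain x where x: "\<And>n. x n \<in> \<rat>" "\<And>n. s < x n" "\<And>n. x n < s + 1 / real (Suc n)" by metis
  have lim: "x \<longlonglongrightarrow> s"
  proof (rule tendsto_sandwich[OF _ _ tendsto_const])
    show "(\<lambda>n. s + 1 / real (Suc n)) \<longlonglongrightarrow> s"
      using tendsto_add[OF tendsto_const[of s] LIMSEQ_Suc[OF lim_1_over_n[where 'a = real]]] by simp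
  qed (use x in \<open>auto intro!: always_eventually less_imp_le\<close>)
  have pos: "0 \<le> x n" for n using s x(2)[of n] by linarith
  have "(\<lambda>n. f (x n)) \<longlonglongrightarrow> f s" "(\<lambda>n. g (x n)) \<longlonglongrightarrow> g s"
    by (rule continuous_on_tendsto_compose[OF f lim] continuous_on_tendsto_compose[OF g lim]; use s pos in auto)+
  moreover have "(\<lambda>n. f (x n)) = (\<lambda>n. g (x n))" using x(1) pos eq by auto
  ultimately show ?thesis by (auto intro: LIMSEQ_unique)
qed

text \<open>
  The integral equation for the velocity has an explicit right-hand side because the integrands are
  constant; integrating it in time gives the position.
\<close>

lemma langevin_solution_eq:
  assumes B: "brownian_motion M B" and W: "brownian_motion M W"
    and sol: "langevin_solution M B W a \<sigma> \<zeta> Z" and t: "0 < t"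
  shows "AE \<omega> in M. Z t \<omega> = vector
    [\<zeta> $ 1 + t * \<zeta> $ 2 + sqrt (a - \<sigma>\<^sup>2) * path_time_integral B t \<omega> - \<sigma> * path_time_integral W t \<omega>,
     \<zeta> $ 2 + sqrt (a - \<sigma>\<^sup>2) * B t \<omega> - \<sigma> * W t \<omega>]"
proof -
  define c where "c = sqrt (a - \<sigma>\<^sup>2)"
  have V: "AE \<omega> in M. Z s \<omega> $ 2 = \<zeta> $ 2 + c * B s \<omega> - \<sigma> * W s \<omega>" if s: "0 \<le> s" for s
  proof -
    have "AE \<omega> in M. Z s \<omega> $ 2 =
        \<zeta> $ 2 + wiener_integral M B s (\<lambda>s. c) \<omega> - wiener_integral M W s (\<lambda>s. \<sigma>) \<omega>"
      using sol s by (simp add: langevin_solution_def c_def)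
    with wiener_integral_const[OF B s, of c] wiener_integral_const[OF W s, of \<sigma>]
    show ?thesis by eventually_elim simp
  qed
  have "AE \<omega> in M. \<forall>s\<in>\<rat> \<inter> {0..}. Z s \<omega> $ 2 = \<zeta> $ 2 + c * B s \<omega> - \<sigma> * W s \<omega>"
    using V by (subst AE_ball_countable) (auto intro: countable_Int1 countable_rat)
  moreover have "AE \<omega> in M. continuous_on {0..} (\<lambda>s. Z s \<omega>)"
    using sol by (simp add: langevin_solution_def)
  moreover have "AE \<omega> in M. continuous_on {0..} (\<lambda>s. B s \<omega>)" "AE \<omega> in M. continuous_on {0..} (\<lambda>s. W s \<omega>)"
    using B W by (simp_all add: brownian_motion_def)
  moreover have "AE \<omega> in M. Z t \<omega> $ 1 = \<zeta> $ 1 + (LBINT s:{0..t}. Z s \<omega> $ 2)"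
    using sol t by (simp add: langevin_solution_def)
  ultimately show ?thesis
    using V[OF less_imp_le[OF t]] path_time_integral_eq[OF B t] path_time_integral_eq[OF W t]
  proof eventually_elim
    case (elim \<omega>)
    have V: "Z s \<omega> $ 2 = \<zeta> $ 2 + c * B s \<omega> - \<sigma> * W s \<omega>" if "0 \<le> s" for s
      by (rule continuous_on_nonneg_eq_of_rationals[OF _ _ _ that])
         (use elim(1) in \<open>auto intro!: continuous_intros elim(2-4)\<close>)
    have int: "set_integrable lborel {0..t} (\<lambda>s. B s \<omega>)" "set_integrable lborel {0..t} (\<lambda>s. W s \<omega>)"
      by (rule borel_integrable_atLeastAtMost', rule continuous_on_subset[OF elim(3)] continuous_on_subset[OF elim(4)], auto)+
    have const: "set_integrable lborel {0..t} (\<lambda>s. \<zeta> $ 2)"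
      by (rule borel_integrable_atLeastAtMost') auto
    have "(LBINT s:{0..t}. Z s \<omega> $ 2) = (LBINT s:{0..t}. \<zeta> $ 2 + c * B s \<omega> - \<sigma> * W s \<omega>)"
      by (rule set_lebesgue_integral_cong) (use V in auto)
    also have "\<dots> = (LBINT s:{0..t}. \<zeta> $ 2) + c * (LBINT s:{0..t}. B s \<omega>) - \<sigma> * (LBINT s:{0..t}. W s \<omega>)"
      using int const by (simp add: set_integral_diff set_integral_add set_integral_mult_right)
    also have "(LBINT s:{0..t}. \<zeta> $ 2) = t * \<zeta> $ 2"
      using t by (simp add: set_lebesgue_integral_def)
    finally have "Z t \<omega> $ 1 = \<zeta> $ 1 + t * \<zeta> $ 2 + c * path_time_integral B t \<omega> - \<sigma> * path_time_integral W t \<omega>"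
      using elim(5,7,8) by simp
    then show ?case using elim(6) by (simp add: vec_eq_iff forall_2 c_def)
  qed
qed

theorem theorem1p2:
  fixes M :: "'a measure" and B W :: "real \<Rightarrow> 'a \<Rightarrow> real" and Z :: "real \<Rightarrow> 'a \<Rightarrow> real^2"
    and a \<sigma> t :: real and \<zeta> :: "real^2" and \<phi> :: "real^2 \<Rightarrow> real"
  assumes "prob_space M"
    and "a > 0" and "0 \<le> \<sigma>" and "\<sigma> < sqrt a"
    and "brownian_motion M B" and "brownian_motion M W" and "indep_processes M B W"
    and "langevin_solution M B W a \<sigma> \<zeta> Z"
    and "\<phi> \<in> borel_measurable borel" and "bounded (range \<phi>)"
    and "t > 0"
  shows "AE \<omega> in M. real_cond_exp M (natural_filtration M W t) (\<lambda>\<omega>. \<phi> (Z t \<omega>)) \<omega> =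
           (\<integral>z. \<phi> z * langevin_fundamental_solution M W a \<sigma> t z \<zeta> \<omega> \<partial>lborel)"
proof -
  interpret prob_space M by fact
  note B = \<open>brownian_motion M B\<close> and W = \<open>brownian_motion M W\<close> and t = \<open>t > 0\<close>
  note \<phi> [measurable] = \<open>\<phi> \<in> borel_measurable borel\<close>
  have "\<sigma>\<^sup>2 < (sqrt a)\<^sup>2" using assms(3,4) by (intro power_strict_mono) auto
  then have a: "\<sigma>\<^sup>2 < a" using assms(2) by simp
  define c where "c = sqrt (a - \<sigma>\<^sup>2)"
  have c: "0 < c" using a by (simp add: c_def)
  define r where "r = sqrt t"
  have r: "0 < r" and rt: "t = r\<^sup>2" using t by (auto simp: r_def)
  define p q where "p = c * r ^ 3 / sqrt 12" and "q = c * r ^ 3 / 2"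
  define N where "N = std_normal_distribution \<Otimes>\<^sub>M std_normal_distribution"
  define F where "F = natural_filtration M W t"
  \<comment> \<open>Two independent standard Gaussians built from \<open>B\<close>; the solution is \<open>m + L G\<close> almost surely.\<close>
  define G where "G \<omega> = (sqrt 12 / sqrt t ^ 3 * (path_time_integral B t \<omega> - t / 2 * B t \<omega>), B t \<omega> / sqrt t)" for \<omega>
  \<comment> \<open>A version of the conditional mean that is measurable for the uncompleted filtration.\<close>
  define m :: "'a \<Rightarrow> real^2"
    where "m \<omega> = vector [\<zeta> $ 1 + t * \<zeta> $ 2 - \<sigma> * path_time_integral W t \<omega>, \<zeta> $ 2 - \<sigma> * W t \<omega>]" for \<omega>
  define L :: "real \<times> real \<Rightarrow> real^2" where "L g = vector [p * fst g + q * snd g, c * r * snd g]" for g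
  obtain C where C: "\<And>z. \<bar>\<phi> z\<bar> \<le> C"
    using \<open>bounded (range \<phi>)\<close> by (auto simp: bounded_iff)
  have F: "subalgebra M F"
    unfolding F_def by (rule subalgebra_natural_filtration) (rule brownian_motion_measurable[OF W])
  have WF: "W s \<in> borel_measurable F" if "s \<in> {0..t}" for s
    unfolding F_def natural_filtration_def by (rule measurable_process_algebra[OF that])
  have mF [measurable]: "m \<in> borel_measurable F"
    using path_time_integral_measurable[OF WF t] WF[of t] t unfolding m_def[abs_def] by simp measurable
  have mM [measurable]: "m \<in> borel_measurable M"
    by (rule measurable_from_subalg[OF F mF])
  have BG: "B s \<in> borel_measurable (process_algebra M B {0..})" if "0 \<le> s" for s
    by (rule measurable_process_algebra) (use that in auto)
  have G: "G \<in> measurable (process_algebra M B {0..}) (borel \<Otimes>\<^sub>M borel)"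
  proof -
    have [measurable]: "path_time_integral B t \<in> borel_measurable (process_algebra M B {0..})"
        "B t \<in> borel_measurable (process_algebra M B {0..})"
      using path_time_integral_measurable[of t B, OF BG t] BG[of t] t by auto
    show ?thesis unfolding G_def[abs_def] by measurable
  qed
  have GM [measurable]: "G \<in> measurable M (borel \<Otimes>\<^sub>M borel)"
  proof -
    have [measurable]: "path_time_integral B t \<in> borel_measurable M" "B t \<in> borel_measurable M"
      using path_time_integral_measurable[of t B, OF brownian_motion_measurable[OF B] t]
        brownian_motion_measurable[OF B, of t] t by auto
    show ?thesis unfolding G_def[abs_def] by measurable
  qed
  have L [measurable]: "L \<in> borel_measurable (borel \<Otimes>\<^sub>M borel)"
    unfolding L_def[abs_def] by measurable
  have GN: "distr M (borel \<Otimes>\<^sub>M borel) G = N"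
    unfolding N_def G_def[abs_def] by (rule brownian_pair_law[OF B t])
  have ZmG: "AE \<omega> in M. Z t \<omega> = m \<omega> + L (G \<omega>)"
    using langevin_solution_eq[OF B W assms(8) t]
  proof eventually_elim
    case (elim \<omega>)
    have "c * r ^ 3 / k * (k / r ^ 3 * (T - r\<^sup>2 / 2 * b)) + c * r ^ 3 / 2 * (b / r) = c * T"
      if "0 < k" for k T b
      using r that by (simp add: field_simps power2_eq_square power3_eq_cube)
    from this[of "sqrt 12" "path_time_integral B t \<omega>" "B t \<omega>"]
    have "p * fst (G \<omega>) + q * snd (G \<omega>) = c * path_time_integral B t \<omega>" "c * r * snd (G \<omega>) = c * B t \<omega>"
      using r unfolding p_def q_def G_def r_def[symmetric] rt[symmetric] by simp_all
    with c show ?case unfolding elim by (auto simp: vec_eq_iff forall_2 m_def L_def simp flip: c_def)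
  qed
  have mean: "AE \<omega> in M. m \<omega> = langevin_mean M W \<sigma> t \<zeta> \<omega>"
    using wiener_integral_eq[OF W has_wiener_integral_path_time_integral[OF W t]]
    by eventually_elim (simp add: m_def langevin_mean_def)
  have "AE \<omega> in M. real_cond_exp M F (\<lambda>\<omega>. \<phi> (Z t \<omega>)) \<omega> = real_cond_exp M F (\<lambda>\<omega>. \<phi> (m \<omega> + L (G \<omega>))) \<omega>"
  proof -
    interpret F: finite_measure_subalgebra M F
      by (intro finite_measure_subalgebra.intro finite_measure_axioms finite_measure_subalgebra_axioms.intro F)
    have [measurable]: "Z t \<in> borel_measurable M" using assms(8) t by (simp add: langevin_solution_def)
    show ?thesis
      by (rule F.real_cond_exp_cong) (use ZmG in auto)
  qed
  moreover have "AE \<omega> in M. real_cond_exp M F (\<lambda>\<omega>. \<phi> (m \<omega> + L (G \<omega>))) \<omega> =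
      (\<integral>g. \<phi> (m \<omega> + L g) \<partial>N)"
    using real_cond_exp_freezing[OF F GM _, of "\<lambda>v. \<phi> (m (fst v) + L (snd v))" C]
      indep_processes_filtration[OF assms(7) G, of t] C
    by (simp add: GN F_def[symmetric])
  ultimately show ?thesis
    using mean unfolding F_def[symmetric]
  proof eventually_elim
    case (elim \<omega>)
    have LN: "distr N borel (\<lambda>g. m \<omega> + L g) =
      density lborel (\<lambda>z. ennreal (triangular_gauss_density p q (c * r) (z - m \<omega>)))"
      using triangular_gauss_law[of p "c * r" "m \<omega>" q] c r
      by (simp add: N_def L_def[abs_def] p_def split_beta')
    have sets: "sets N = sets (borel \<Otimes>\<^sub>M borel)"
      unfolding N_def by (intro sets_pair_measure_cong) auto
    have "(\<integral>g. \<phi> (m \<omega> + L g) \<partial>N) = (\<integral>z. \<phi> z \<partial>distr N borel (\<lambda>g. m \<omega> + L g))"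
      by (rule integral_distr[symmetric]) (auto simp: measurable_cong_sets[OF sets refl])
    also have "\<dots> = (\<integral>z. triangular_gauss_density p q (c * r) (z - m \<omega>) * \<phi> z \<partial>lborel)"
      unfolding LN using c r
      by (subst integral_density) (auto simp: p_def intro!: triangular_gauss_density_nonneg)
    also have "\<dots> = (\<integral>z. \<phi> z * langevin_fundamental_solution M W a \<sigma> t z \<zeta> \<omega> \<partial>lborel)"
      unfolding langevin_fundamental_solution_eq[OF a t] elim(3) p_def q_def c_def r_def
      by (simp add: mult.commute)
    finally show ?case using elim(1,2) by simp
  qed
qed

end
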